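(* Let $\mathfrak H$ be a Hilbert space and let $\beta$ be the strict topology on $\mathcal B(\mathfrak H)$. The locally convex space $(\mathcal B(\mathfrak H),\beta)$ is strong Mackey, and together with the operator norm it satisfies Condition C.
   Context: $\mathcal B(\mathfrak H)$ and $\mathcal K(\mathfrak H)$ denote the bounded and the compact operators on $\mathfrak H$. The strict topology $\beta$ on $\mathcal B(\mathfrak H)$ is the locally convex topology generated by the semi-norms $A\mapsto\|AB\|$ and $A\mapsto\|BA\|$, $B\in\mathcal K(\mathfrak H)$. A locally convex space $(X,\tau)$ with continuous dual $X'$ is strong Mackey if all $\sigma(X',X)$-compact sets in $X'$ are equi-continuous. $(X,\tau,\|\cdot\|)$ satisfies Condition C if: (a) $(X,\tau)$ is sequentially complete; (b) $\tau$ is weaker than the norm topology; (c) both topologies have the same bounded sets; (d) $\mathcal N$ is countably convex, where $\mathcal N$ is the set of $\tau$-continuous semi-norms $p$ with $p\le\|\cdot\|$, and countably convex means that for every sequence $p_n\in\mathcal N$ and $\alpha_n\ge0$ with $\sum_n\alpha_n=1$ one has $\sum_n\alpha_np_n\in\mathcal N$. *)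

theory Defs
  imports "HOL-Analysis.Analysis"
begin

subsection \<open>Complex Hilbert spaces\<close>

class complex_vector = real_vector +
  fixes scaleC :: "complex \<Rightarrow> 'a \<Rightarrow> 'a"  (infixr "*\<^sub>C" 75)
  assumes scaleC_add_right: "a *\<^sub>C (x + y) = a *\<^sub>C x + a *\<^sub>C y"
    and scaleC_add_left: "(a + b) *\<^sub>C x = a *\<^sub>C x + b *\<^sub>C x"
    and scaleC_scaleC: "a *\<^sub>C (b *\<^sub>C x) = (a * b) *\<^sub>C x"
    and scaleC_one: "1 *\<^sub>C x = x"
    and scaleR_scaleC: "r *\<^sub>R x = complex_of_real r *\<^sub>C x"

class complex_normed_vector = complex_vector + real_normed_vector +
  assumes norm_scaleC: "norm (a *\<^sub>C x) = cmod a * norm x"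

class complex_inner = complex_normed_vector +
  fixes cinner :: "'a \<Rightarrow> 'a \<Rightarrow> complex"
  assumes cinner_commute: "cinner x y = cnj (cinner y x)"
    and cinner_add_left: "cinner (x + y) z = cinner x z + cinner y z"
    and cinner_scaleC_left: "cinner (a *\<^sub>C x) y = a * cinner x y"
    and cinner_ge_zero: "0 \<le> Re (cinner x x)"
    and cinner_eq_zero_iff: "cinner x x = 0 \<longleftrightarrow> x = 0"
    and norm_eq_sqrt_cinner: "norm x = sqrt (Re (cinner x x))"

class chilbert_space = complex_inner + complete_space

instantiation complex :: chilbert_space
begin

definition scaleC_complex :: "complex \<Rightarrow> complex \<Rightarrow> complex" where
  "scaleC_complex a x = a * x"

definition cinner_complex :: "complex \<Rightarrow> complex \<Rightarrow> complex" where
  "cinner_complex x y = x * cnj y"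

instance
proof
  fix x :: complex
  show "norm x = sqrt (Re (cinner x x))"
    by (simp add: cinner_complex_def cmod_def power2_eq_square)
qed (auto simp: scaleC_complex_def cinner_complex_def algebra_simps scaleR_conv_of_real norm_mult)

end

abbreviation clinear :: "('a::complex_vector \<Rightarrow> 'b::complex_vector) \<Rightarrow> bool" where
  "clinear \<equiv> Vector_Spaces.linear scaleC scaleC"

lemma clinear_iff:
  "clinear f \<longleftrightarrow> (\<forall>x y. f (x + y) = f x + f y) \<and> (\<forall>c x. f (c *\<^sub>C x) = c *\<^sub>C f x)"
proof -
  have "vector_space (scaleC :: complex \<Rightarrow> 'a \<Rightarrow> 'a)" "vector_space (scaleC :: complex \<Rightarrow> 'b \<Rightarrow> 'b)"
    by (unfold_locales;
        simp add: scaleC_add_right scaleC_add_left scaleC_scaleC scaleC_one)+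
  then show ?thesis
    unfolding Vector_Spaces.linear_def module_hom_def module_hom_axioms_def
    by (auto simp: module_iff_vector_space)
qed


lemma scaleC_zero: "a *\<^sub>C (0::'a::complex_vector) = 0"
  by (metis add_cancel_right_right scaleC_add_right)


subsection \<open>The bounded operators on a Hilbert space\<close>

text \<open>The library's bounded linear maps are real-linear, so complex homogeneity is added here.
  The norm inherited from them is the operator norm.\<close>

typedef (overloaded) 'h bop = "{A :: 'h::complex_normed_vector \<Rightarrow>\<^sub>L 'h. clinear (blinfun_apply A)}"
  morphisms blinfun_of_bop Abs_bop
  by (rule exI[of _ 0]) (simp add: clinear_iff scaleC_zero)

setup_lifting type_definition_bop

lift_definition bop_apply :: "'h::complex_normed_vector bop \<Rightarrow> 'h \<Rightarrow> 'h" is blinfun_apply .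

lift_definition bop_compose ::
  "'h::complex_normed_vector bop \<Rightarrow> 'h bop \<Rightarrow> 'h bop"  (infixl "o\<^sub>B" 55)
  is "\<lambda>A B. A o\<^sub>L B"
  by (simp add: clinear_iff)

lemma scaleC_minus: "a *\<^sub>C (- x) = - (a *\<^sub>C (x::'a::complex_vector))"
  by (metis add.right_inverse add_eq_0_iff scaleC_add_right scaleC_zero)

lemma scaleC_diff: "a *\<^sub>C (x - y) = a *\<^sub>C x - a *\<^sub>C (y::'a::complex_vector)"
  using scaleC_add_right[of a x "- y"] by (simp add: scaleC_minus)

lemma scaleC_scaleR_commute: "a *\<^sub>C (r *\<^sub>R x) = r *\<^sub>R (a *\<^sub>C (x::'a::complex_vector))"
  by (simp add: scaleR_scaleC scaleC_scaleC mult.commute)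

lemma bounded_linear_scaleC:
  "bounded_linear (\<lambda>x. a *\<^sub>C (x::'a::complex_normed_vector))"
  by (rule bounded_linear_intro[of _ "cmod a"])
     (simp_all add: scaleC_add_right scaleC_scaleR_commute norm_scaleC mult.commute)

instantiation bop :: (complex_normed_vector) complex_normed_vector
begin

lift_definition zero_bop :: "'a bop" is 0
  by (simp add: clinear_iff scaleC_zero)

lift_definition plus_bop :: "'a bop \<Rightarrow> 'a bop \<Rightarrow> 'a bop" is "(+)"
  by (simp add: clinear_iff blinfun.add_left scaleC_add_right)

lift_definition minus_bop :: "'a bop \<Rightarrow> 'a bop \<Rightarrow> 'a bop" is "(-)"
  by (simp add: clinear_iff blinfun.diff_left scaleC_diff)

lift_definition uminus_bop :: "'a bop \<Rightarrow> 'a bop" is uminus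
  by (simp add: clinear_iff blinfun.minus_left scaleC_minus)

lift_definition scaleR_bop :: "real \<Rightarrow> 'a bop \<Rightarrow> 'a bop" is scaleR
  by (simp add: clinear_iff blinfun.scaleR_left scaleC_scaleR_commute scaleR_add_right)

lift_definition scaleC_bop :: "complex \<Rightarrow> 'a bop \<Rightarrow> 'a bop" is
  "\<lambda>c A. Blinfun (\<lambda>x. c *\<^sub>C blinfun_apply A x)"
  by (simp add: clinear_iff bounded_linear_Blinfun_apply
      bounded_linear_compose[OF bounded_linear_scaleC] blinfun.bounded_linear_right
      scaleC_add_right scaleC_scaleC mult.commute)

lift_definition norm_bop :: "'a bop \<Rightarrow> real" is norm .

definition sgn_bop :: "'a bop \<Rightarrow> 'a bop" where
  "sgn_bop A = inverse (norm A) *\<^sub>R A"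

definition dist_bop :: "'a bop \<Rightarrow> 'a bop \<Rightarrow> real" where
  "dist_bop A B = norm (A - B)"

definition uniformity_bop :: "('a bop \<times> 'a bop) filter" where
  "uniformity_bop = (INF e\<in>{0 <..}. principal {(A, B). dist A B < e})"

definition open_bop :: "'a bop set \<Rightarrow> bool" where
  "open_bop U \<longleftrightarrow> (\<forall>A\<in>U. eventually (\<lambda>(A', B). A' = A \<longrightarrow> B \<in> U) uniformity)"

lemma blinfun_apply_scaleC_bop:
  "blinfun_apply (blinfun_of_bop (c *\<^sub>C A)) x = c *\<^sub>C blinfun_apply (blinfun_of_bop A) x"
  by transfer (simp add: bounded_linear_Blinfun_apply
      bounded_linear_compose[OF bounded_linear_scaleC] blinfun.bounded_linear_right)

instance
proof
  fix a b :: complex and r s :: real and A B C :: "'a bop" and U :: "'a bop set"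
  show "A + B + C = A + (B + C)" "A + B = B + A" "0 + A = A" "- A + A = 0" "A - B = A + - B"
    by (transfer; simp)+
  show "r *\<^sub>R (A + B) = r *\<^sub>R A + r *\<^sub>R B" "(r + s) *\<^sub>R A = r *\<^sub>R A + s *\<^sub>R A"
    "r *\<^sub>R s *\<^sub>R A = (r * s) *\<^sub>R A" "1 *\<^sub>R A = A"
    by (transfer; simp add: algebra_simps)+
  have ext: "A = B" if "\<And>x. blinfun_apply (blinfun_of_bop A) x = blinfun_apply (blinfun_of_bop B) x"
    for A B :: "'a bop"
    using that by (metis blinfun_eqI blinfun_of_bop_inject)
  show "a *\<^sub>C (A + B) = a *\<^sub>C A + a *\<^sub>C B" "(a + b) *\<^sub>C A = a *\<^sub>C A + b *\<^sub>C A"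
    "a *\<^sub>C b *\<^sub>C A = (a * b) *\<^sub>C A" "1 *\<^sub>C A = A" "r *\<^sub>R A = complex_of_real r *\<^sub>C A"
    by (rule ext, simp add: blinfun_apply_scaleC_bop plus_bop.rep_eq scaleR_bop.rep_eq
        blinfun.add_left blinfun.scaleR_left scaleC_add_right scaleC_add_left scaleC_scaleC
        scaleC_one scaleR_scaleC)+
  show "sgn A = inverse (norm A) *\<^sub>R A" by (rule sgn_bop_def)
  show "dist A B = norm (A - B)" by (rule dist_bop_def)
  show "uniformity = (INF e\<in>{0 <..}. principal {(A, B :: 'a bop). dist A B < e})"
    by (rule uniformity_bop_def)
  show "open U \<longleftrightarrow> (\<forall>A\<in>U. \<forall>\<^sub>F (A', B) in uniformity. A' = A \<longrightarrow> B \<in> U)"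
    by (rule open_bop_def)
  show "norm A = 0 \<longleftrightarrow> A = 0" "norm (r *\<^sub>R A) = \<bar>r\<bar> * norm A"
    by (transfer; simp)+
  show "norm (A + B) \<le> norm A + norm B" by transfer (rule norm_triangle_ineq)
  show "norm (a *\<^sub>C A) = cmod a * norm A"
  proof -
    have "norm (blinfun_of_bop (a *\<^sub>C A)) = onorm (\<lambda>x. a *\<^sub>C blinfun_apply (blinfun_of_bop A) x)"
      by (simp add: norm_blinfun.rep_eq blinfun_apply_scaleC_bop[abs_def])
    also have "\<dots> = onorm (\<lambda>x. cmod a *\<^sub>R blinfun_apply (blinfun_of_bop A) x)"
      by (simp add: onorm_def norm_scaleC)
    also have "\<dots> = cmod a * norm (blinfun_of_bop A)"
      by (simp add: onorm_scaleR blinfun.bounded_linear_right norm_blinfun.rep_eq)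
    finally show ?thesis by (simp add: norm_bop.rep_eq)
  qed
qed

end

definition compact_bop :: "'h::complex_normed_vector bop \<Rightarrow> bool" where
  "compact_bop B \<longleftrightarrow> compact (closure (bop_apply B ` cball 0 1))"


subsection \<open>Locally convex spaces\<close>

definition cseminorm :: "('a::complex_vector \<Rightarrow> real) \<Rightarrow> bool" where
  "cseminorm p \<longleftrightarrow>
     (\<forall>x y. p (x + y) \<le> p x + p y) \<and> (\<forall>c x. p (c *\<^sub>C x) = cmod c * p x)"

text \<open>The Hausdorff property is not required here.  For spaces satisfying Condition C it follows,
  because no nontrivial subspace is norm bounded.\<close>

definition locally_convex_space :: "'a::complex_vector topology \<Rightarrow> bool" where
  "locally_convex_space \<tau> \<longleftrightarrow>
     topspace \<tau> = UNIV \<and>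
     continuous_map (prod_topology \<tau> \<tau>) \<tau> (\<lambda>(x, y). x + y) \<and>
     continuous_map (prod_topology euclidean \<tau>) \<tau> (\<lambda>(c, x). c *\<^sub>C x) \<and>
     (\<forall>U. openin \<tau> U \<and> 0 \<in> U \<longrightarrow> (\<exists>V. openin \<tau> V \<and> 0 \<in> V \<and> convex V \<and> V \<subseteq> U))"

definition seminorm_topology :: "('a::complex_vector \<Rightarrow> real) set \<Rightarrow> 'a topology" where
  "seminorm_topology P =
     topology_generated_by {{y. p (y - x) < e} | p x e. p \<in> P \<and> 0 < e}"

definition continuous_dual :: "'a::complex_vector topology \<Rightarrow> ('a \<Rightarrow> complex) set" where
  "continuous_dual \<tau> = {f. clinear f \<and> continuous_map \<tau> euclidean f}"

text \<open>The topology \<open>\<sigma>(X', X)\<close>: pointwise convergence on \<open>X\<close>.\<close>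

definition weak_dual_topology :: "'a::complex_vector topology \<Rightarrow> ('a \<Rightarrow> complex) topology" where
  "weak_dual_topology \<tau> =
     subtopology (product_topology (\<lambda>_. euclidean) UNIV) (continuous_dual \<tau>)"

definition equicontinuous_in :: "'a topology \<Rightarrow> ('a \<Rightarrow> complex) set \<Rightarrow> bool" where
  "equicontinuous_in \<tau> K \<longleftrightarrow>
     (\<forall>x\<in>topspace \<tau>. \<forall>e>0. \<exists>U. openin \<tau> U \<and> x \<in> U \<and> (\<forall>f\<in>K. \<forall>y\<in>U. dist (f y) (f x) < e))"

definition strong_Mackey :: "'a::complex_vector topology \<Rightarrow> bool" where
  "strong_Mackey \<tau> \<longleftrightarrow>
     locally_convex_space \<tau> \<and>
     (\<forall>K. compactin (weak_dual_topology \<tau>) K \<longrightarrow> equicontinuous_in \<tau> K)"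

definition Cauchy_in :: "'a::complex_vector topology \<Rightarrow> (nat \<Rightarrow> 'a) \<Rightarrow> bool" where
  "Cauchy_in \<tau> s \<longleftrightarrow>
     (\<forall>U. openin \<tau> U \<and> 0 \<in> U \<longrightarrow> (\<exists>N. \<forall>m\<ge>N. \<forall>n\<ge>N. s m - s n \<in> U))"

definition sequentially_complete :: "'a::complex_vector topology \<Rightarrow> bool" where
  "sequentially_complete \<tau> \<longleftrightarrow>
     (\<forall>s. Cauchy_in \<tau> s \<longrightarrow> (\<exists>l. limitin \<tau> s l sequentially))"

definition bounded_in :: "'a::complex_vector topology \<Rightarrow> 'a set \<Rightarrow> bool" where
  "bounded_in \<tau> S \<longleftrightarrow>
     (\<forall>U. openin \<tau> U \<and> 0 \<in> U \<longrightarrow> (\<exists>r>0. \<forall>c. r \<le> cmod c \<longrightarrow> S \<subseteq> (\<lambda>x. c *\<^sub>C x) ` U))"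

definition dominated_seminorms ::
    "'a::complex_normed_vector topology \<Rightarrow> ('a \<Rightarrow> real) set" where
  "dominated_seminorms \<tau> =
     {p. cseminorm p \<and> continuous_map \<tau> euclidean p \<and> (\<forall>x. p x \<le> norm x)}"

text \<open>For \<open>N = dominated_seminorms \<tau>\<close> the pointwise series converges, its terms being
  bounded by \<open>\<alpha> n * norm x\<close>.\<close>

definition countably_convex :: "('a \<Rightarrow> real) set \<Rightarrow> bool" where
  "countably_convex N \<longleftrightarrow>
     (\<forall>p \<alpha>. (\<forall>n::nat. p n \<in> N) \<and> (\<forall>n. 0 \<le> \<alpha> n) \<and> \<alpha> sums 1 \<longrightarrow>
        (\<lambda>x. \<Sum>n. \<alpha> n * p n x) \<in> N)"

definition condition_C :: "'a::complex_normed_vector topology \<Rightarrow> bool" where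
  "condition_C \<tau> \<longleftrightarrow>
     locally_convex_space \<tau> \<and>
     sequentially_complete \<tau> \<and>
     (\<forall>U. openin \<tau> U \<longrightarrow> open U) \<and>
     (\<forall>S. bounded_in \<tau> S \<longleftrightarrow> bounded S) \<and>
     countably_convex (dominated_seminorms \<tau>)"


subsection \<open>The strict topology\<close>

definition strict_topology :: "'h::chilbert_space bop topology" where
  "strict_topology = seminorm_topology
     ({\<lambda>A. norm (A o\<^sub>B B) | B. compact_bop B} \<union> {\<lambda>A. norm (B o\<^sub>B A) | B. compact_bop B})"

end

theory Submission
  imports Defs
begin

text \<open>A seminorm \<open>p \<le> C * norm\<close> is strictly continuous iff it is small on large finite
  codimension: for every \<open>e > 0\<close> there is a finite set \<open>V\<close> such that \<open>p A \<le> e * norm A\<close> whenever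
  \<open>A\<close> and its adjoint vanish on \<open>V\<close>.  This criterion passes to uniform limits on the unit ball,
  whence countable convexity, and it makes sense uniformly for a set of functionals.  If it failed
  for a weakly compact set \<open>K\<close> in the dual, one could choose \<open>f n \<in> K\<close> and contractions \<open>A n\<close>
  living on mutually orthogonal finite-dimensional blocks with \<open>\<bar>f n (A n)\<bar> > e\<close>.  Each \<open>f \<in> K\<close> then
  induces a countably additive set function \<open>S \<mapsto> f (\<Sum>n\<in>S. A n)\<close>, and a Vitali--Hahn--Saks type
  argument contradicts compactness.\<close>

text \<open>For a seminorm, continuity with respect to \<open>\<beta>\<close> need only be tested on
  the norm unit ball, where \<open>\<beta>\<close> is the strong* topology; hence the condition on
  both \<open>A\<close> and its adjoint, the families \<open>norm (A * B)\<close> and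
  \<open>norm (B * A)\<close> seeing the two sides. To return from the criterion to continuity, one
  compact \<open>B\<close> is built from a sequence of finite sets alone. As \<open>B\<close> does
  not refer to an individual seminorm, the same construction serves one seminorm and a whole set of
  functionals, and a common bound through a common \<open>B\<close> is equicontinuity.

  The obstacle is that a \<open>\<sigma>(X', X)\<close>-compact set is assumed neither convex nor
  sequentially compact, so no convergent subsequence of the \<open>f n\<close> is at hand. Cluster
  points, tested on finitely many operators at a time, have to suffice; they do because an initial
  segment of the indices has only finitely many subsets.

  The rest of Condition C rests on rank one operators, which make pointwise values visible to
  \<open>\<beta>\<close>, and on uniform boundedness.\<close>

instance chilbert_space \<subseteq> banach ..

section \<open>Uniform boundedness\<close>

lemma Banach_Steinhaus:
  fixes K :: "('a::banach \<Rightarrow> 'b::real_normed_vector) set"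
  assumes lin: "\<And>f. f \<in> K \<Longrightarrow> bounded_linear f"
    and bdd: "\<And>x. \<exists>c. \<forall>f\<in>K. norm (f x) \<le> c"
  obtains C where "C > 0" "\<And>f x. f \<in> K \<Longrightarrow> norm (f x) \<le> C * norm x"
proof -
  define G where "G n = {x. \<forall>f\<in>K. norm (f x) \<le> real n}" for n
  have cl: "closed (G n)" for n
  proof -
    have "G n = (\<Inter>f\<in>K. {x. norm (f x) \<le> real n})"
      by (auto simp: G_def)
    moreover have "closed {x. norm (f x) \<le> real n}" if "f \<in> K" for f
      using lin[OF that]
      by (intro closed_Collect_le continuous_intros) (simp add: linear_continuous_on)
    ultimately show ?thesis
      by auto
  qed
  have UN: "\<Union>(range G) = UNIV"
    using bdd by (auto simp: G_def) (meson order_trans real_arch_simple)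
  have "\<exists>n. interior (G n) \<noteq> {}"
  proof (rule ccontr)
    assume "\<not> ?thesis"
    then have "euclidean interior_of \<Union>(range G) = {}"
      using cl
      by (intro Baire_category_alt) (auto simp: completely_metrizable_space_euclidean)
    then show False
      unfolding UN by simp
  qed
  then obtain n x0 e where e: "e > 0" "cball x0 e \<subseteq> G n"
    by (metis all_not_in_conv mem_interior_cball)
  show ?thesis
  proof
    \<comment> \<open>The added 1 only makes the constant positive, since \<open>n\<close> may be
      0.\<close>
    show "2 * real n / e + 1 > 0"
      using e by (simp add: add_nonneg_pos)
  next
    fix f x
    assume f: "f \<in> K"
    interpret bounded_linear f
      by (rule lin) fact
    show "norm (f x) \<le> (2 * real n / e + 1) * norm x"
    proof (cases "x = 0")
      case False
      \<comment> \<open>\<open>y\<close> has norm \<open>e\<close>, so both \<open>x0\<close> and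
        \<open>x0 + y\<close> lie in the ball; taking their difference costs the factor 2.\<close>
      define y where "y = (e / norm x) *\<^sub>R x"
      have "x0 + y \<in> G n" "x0 \<in> G n"
        using e False by (auto simp: y_def dist_norm subset_iff)
      then have "norm (f (x0 + y) - f x0) \<le> real n + real n"
        using f by (intro order_trans[OF norm_triangle_ineq4] add_mono) (auto simp: G_def)
      then have "norm (f y) \<le> 2 * real n"
        by (simp add: add)
      also have "f y = (e / norm x) *\<^sub>R f x"
        by (simp add: y_def scaleR)
      finally have "norm (f x) \<le> 2 * real n / e * norm x"
        using e False by (simp add: field_simps)
      then show ?thesis
        by (simp add: distrib_right add_increasing2)
    qed (simp add: zero)
  qed
qed

subsection \<open>Complex inner product spaces\<close>

lemma scaleC_zero_left [simp]: "0 *\<^sub>C (x::'a::complex_vector) = 0"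
  using scaleR_scaleC[of 0 x] by simp


lemma cinner_add_right:
  fixes x y z :: "'a::complex_inner"
  shows "cinner x (y + z) = cinner x y + cinner x z"
  by (metis cinner_add_left cinner_commute complex_cnj_add)

lemma cinner_scaleC_right:
  fixes x y :: "'a::complex_inner"
  shows "cinner x (a *\<^sub>C y) = cnj a * cinner x y"
  by (metis cinner_scaleC_left cinner_commute complex_cnj_mult)

lemma cinner_zero_left [simp]:
  fixes x :: "'a::complex_inner"
  shows "cinner 0 x = 0"
  using cinner_add_left[of 0 0 x] by simp

lemma cinner_zero_right [simp]:
  fixes x :: "'a::complex_inner"
  shows "cinner x 0 = 0"
  by (metis cinner_zero_left cinner_commute complex_cnj_zero)

lemma cinner_minus_left [simp]:
  fixes x y :: "'a::complex_inner"
  shows "cinner (- x) y = - cinner x y"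
  using cinner_add_left[of "- x" x y] by (simp add: add_eq_0_iff2)

lemma cinner_minus_right [simp]:
  fixes x y :: "'a::complex_inner"
  shows "cinner x (- y) = - cinner x y"
  by (metis cinner_minus_left cinner_commute complex_cnj_minus)

lemma cinner_diff_left:
  fixes x y z :: "'a::complex_inner"
  shows "cinner (x - y) z = cinner x z - cinner y z"
  using cinner_add_left[of x "- y" z] by simp

lemma cinner_diff_right:
  fixes x y z :: "'a::complex_inner"
  shows "cinner x (y - z) = cinner x y - cinner x z"
  using cinner_add_right[of x y "- z"] by simp

lemma cinner_scaleR_left:
  fixes x y :: "'a::complex_inner"
  shows "cinner (r *\<^sub>R x) y = of_real r * cinner x y"
  by (simp add: scaleR_scaleC cinner_scaleC_left)

lemma cinner_scaleR_right:
  fixes x y :: "'a::complex_inner"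
  shows "cinner x (r *\<^sub>R y) = of_real r * cinner x y"
  by (simp add: scaleR_scaleC cinner_scaleC_right)

lemma cinner_sum_left:
  fixes y :: "'a::complex_inner"
  shows "cinner (\<Sum>i\<in>I. f i) y = (\<Sum>i\<in>I. cinner (f i) y)"
  by (induction I rule: infinite_finite_induct) (auto simp: cinner_add_left)

lemma cinner_sum_right:
  fixes y :: "'a::complex_inner"
  shows "cinner y (\<Sum>i\<in>I. f i) = (\<Sum>i\<in>I. cinner y (f i))"
  by (induction I rule: infinite_finite_induct) (auto simp: cinner_add_right)

lemma cinner_self:
  fixes x :: "'a::complex_inner"
  shows "cinner x x = of_real ((norm x)\<^sup>2)"
proof (rule complex_eqI)
  show "Re (cinner x x) = Re (of_real ((norm x)\<^sup>2))"
    by (simp add: norm_eq_sqrt_cinner cinner_ge_zero)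
  have "Im (cinner x x) = - Im (cinner x x)"
    by (metis cinner_commute cnj.simps(2))
  then show "Im (cinner x x) = Im (of_real ((norm x)\<^sup>2))"
    by simp
qed

lemma power2_norm_eq_cinner:
  fixes x :: "'a::complex_inner"
  shows "(norm x)\<^sup>2 = Re (cinner x x)"
  by (simp add: cinner_self)

lemma power2_norm_add:
  fixes x y :: "'a::complex_inner"
  shows "(norm (x + y))\<^sup>2 = (norm x)\<^sup>2 + (norm y)\<^sup>2 + 2 * Re (cinner x y)"
proof -
  have "Re (cinner y x) = Re (cinner x y)"
    by (subst cinner_commute) simp
  then show ?thesis
    by (simp add: power2_norm_eq_cinner cinner_add_left cinner_add_right)
qed

lemma power2_norm_diff:
  fixes x y :: "'a::complex_inner"
  shows "(norm (x - y))\<^sup>2 = (norm x)\<^sup>2 + (norm y)\<^sup>2 - 2 * Re (cinner x y)"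
  using power2_norm_add[of x "- y"] by (simp add: power2_norm_eq_cinner)

lemma pythagoras:
  fixes x y :: "'a::complex_inner"
  assumes "cinner x y = 0"
  shows "(norm (x + y))\<^sup>2 = (norm x)\<^sup>2 + (norm y)\<^sup>2"
  using assms by (simp add: power2_norm_add)

lemma cinner_ext:
  fixes x y :: "'a::complex_inner"
  assumes "\<And>z. cinner z x = cinner z y"
  shows "x = y"
  using assms[of "x - y"] cinner_eq_zero_iff[of "x - y"]
  by (simp add: cinner_diff_right)

text \<open>Cauchy-Schwarz: \<open>c *\<^sub>C y\<close> is the component of \<open>x\<close> along
  \<open>y\<close>, and by Pythagoras it is no longer than \<open>x\<close>.\<close>

lemma cmod_cinner_le:
  fixes x y :: "'a::complex_inner"
  shows "cmod (cinner x y) \<le> norm x * norm y"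
proof (cases "y = 0")
  case False
  define c where "c = cinner x y / of_real ((norm y)\<^sup>2)"
  have y: "(norm y)\<^sup>2 > 0"
    using False cinner_eq_zero_iff[of y] cinner_self[of y] by auto
  have "cinner (c *\<^sub>C y) (x - c *\<^sub>C y) = c * cnj (cinner x y - c * of_real ((norm y)\<^sup>2))"
    using cinner_commute[of y x]
    by (simp add: cinner_scaleC_left cinner_scaleC_right cinner_diff_right cinner_self[of y]
        algebra_simps)
  also have "\<dots> = 0"
    using y by (simp add: c_def)
  finally have "(norm (c *\<^sub>C y + (x - c *\<^sub>C y)))\<^sup>2 = (norm (c *\<^sub>C y))\<^sup>2 + (norm (x - c *\<^sub>C y))\<^sup>2"
    by (rule pythagoras)
  then have "(norm x)\<^sup>2 = (cmod c * norm y)\<^sup>2 + (norm (x - c *\<^sub>C y))\<^sup>2"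
    by (simp add: norm_scaleC)
  then have "(cmod c * norm y)\<^sup>2 \<le> (norm x)\<^sup>2"
    by simp
  then have "cmod c * norm y \<le> norm x"
    by (rule power2_le_imp_le) simp
  then have "cmod c * norm y * norm y \<le> norm x * norm y"
    by (rule mult_right_mono) simp
  moreover have "cmod c * norm y * norm y = cmod (cinner x y)"
    using y by (simp add: c_def norm_divide power2_eq_square norm_mult)
  ultimately show ?thesis
    by simp
qed simp

text \<open>Testing with \<open>z = x\<close> is enough. This is how bounds on
  \<open>adj A v\<close> are obtained from bounds on scalar products.\<close>

lemma norm_le_of_cinner:
  fixes x :: "'a::complex_inner"
  assumes "\<And>z. cmod (cinner z x) \<le> c * norm z" "0 \<le> c"
  shows "norm x \<le> c"
proof -
  have "norm x * norm x \<le> c * norm x"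
    using assms(1)[of x] by (simp add: cinner_self power2_eq_square norm_mult)
  then show ?thesis
    using assms(2) by (metis mult_le_cancel_right norm_ge_zero order_antisym_conv order_refl
        linorder_not_less)
qed

lemma bounded_linear_cinner_left: "bounded_linear (\<lambda>x. cinner x (y::'a::complex_inner))"
  by (rule bounded_linear_intro[of _ "norm y"])
     (auto simp: cinner_add_left cinner_scaleR_left cmod_cinner_le scaleR_conv_of_real)

text \<open>The functional \<open>x \<mapsto> \<bar>x\<bar>\<^sup>2 - 2 Re (\<phi> x)\<close> has a minimizer: minimizing sequences are
  Cauchy by the parallelogram law, and stationarity identifies the limit.\<close>

lemma Riesz_representation:
  fixes \<phi> :: "'h::chilbert_space \<Rightarrow> complex"
  assumes add: "\<And>x y. \<phi> (x + y) = \<phi> x + \<phi> y"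
    and scale: "\<And>c x. \<phi> (c *\<^sub>C x) = c * \<phi> x"
    and bdd: "\<And>x. cmod (\<phi> x) \<le> C * norm x"
  shows "\<exists>u. \<forall>x. \<phi> x = cinner x u"
proof -
  define J where "J x = (norm x)\<^sup>2 - 2 * Re (\<phi> x)" for x
  have scaleR: "\<phi> (r *\<^sub>R x) = of_real r * \<phi> x" for r x
    by (simp add: scaleR_scaleC scale)
  have bl: "bounded_linear \<phi>"
    by (rule bounded_linear_intro[of _ C])
       (auto simp: add scaleR bdd scaleR_conv_of_real mult.commute)
  define m where "m = Inf (range J)"
  have "- C\<^sup>2 \<le> J x" for x
  proof -
    have "Re (\<phi> x) \<le> C * norm x"
      using bdd[of x] complex_Re_le_cmod[of "\<phi> x"] by linarith
    moreover have "0 \<le> (norm x - C)\<^sup>2"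
      by simp
    ultimately show ?thesis
      unfolding J_def power2_diff by (simp add: mult.commute)
  qed
  then have bb: "bdd_below (range J)"
    by (intro bdd_belowI2)
  then have m_le: "m \<le> J x" for x
    unfolding m_def by (intro cInf_lower) auto
  \<comment> \<open>For the midpoint \<open>z\<close> the parallelogram law reads
    \<open>J x + J y - 2 * J z = (norm (x - y))\<^sup>2 / 2\<close>, and \<open>J z\<close> is at
    least \<open>m\<close>.\<close>
  have par: "(norm (x - y))\<^sup>2 \<le> 2 * (J x + J y - 2 * m)" for x y
  proof -
    define z where "z = (1/2) *\<^sub>R (x + y)"
    have "(norm z)\<^sup>2 = (norm (x + y))\<^sup>2 / 4"
      by (simp add: z_def power_divide)
    moreover have "Re (\<phi> z) = (Re (\<phi> x) + Re (\<phi> y)) / 2"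
      by (simp add: z_def scaleR add)
    ultimately have "J z = (norm (x + y))\<^sup>2 / 4 - (Re (\<phi> x) + Re (\<phi> y))"
      by (simp add: J_def)
    then have "4 * m \<le> (norm x)\<^sup>2 + (norm y)\<^sup>2 + 2 * Re (cinner x y) - 4 * Re (\<phi> x) - 4 * Re (\<phi> y)"
      using m_le[of z] unfolding power2_norm_add by argo
    then show ?thesis
      unfolding J_def power2_norm_diff by argo
  qed
  have "\<exists>x. J x < m + inverse (real (Suc n))" for n
    using cInf_lessD[of "range J" "m + inverse (real (Suc n))"] by (auto simp: m_def)
  then obtain s where s: "\<And>n. J (s n) < m + inverse (real (Suc n))"
    by metis
  have "Cauchy s"
  proof (rule metric_CauchyI)
    fix e :: real
    assume e: "e > 0"
    obtain N where N: "inverse (real (Suc N)) < e\<^sup>2 / 4"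
      using reals_Archimedean[of "e\<^sup>2 / 4"] e by auto
    have small: "J (s n) < m + e\<^sup>2 / 4" if "n \<ge> N" for n
    proof -
      have "inverse (real (Suc n)) \<le> inverse (real (Suc N))"
        using that by (intro le_imp_inverse_le) auto
      then show ?thesis
        using s[of n] N by linarith
    qed
    have "dist (s i) (s j) < e" if "i \<ge> N" "j \<ge> N" for i j
    proof -
      have "(norm (s i - s j))\<^sup>2 < e\<^sup>2"
        using par[of "s i" "s j"] small[OF that(1)] small[OF that(2)] by argo
      then show ?thesis
        using e by (simp add: dist_norm power2_less_imp_less)
    qed
    then show "\<exists>N. \<forall>i\<ge>N. \<forall>j\<ge>N. dist (s i) (s j) < e"
      by blast
  qed
  then obtain u where u: "s \<longlonglongrightarrow> u"
    by (auto simp: Cauchy_convergent_iff convergent_def)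
  have "(\<lambda>n. J (s n)) \<longlonglongrightarrow> J u"
    unfolding J_def using bounded_linear.tendsto[OF bl u] u by (intro tendsto_intros)
  moreover have "(\<lambda>n. m + inverse (real (Suc n))) \<longlonglongrightarrow> m + 0"
    by (intro tendsto_intros LIMSEQ_inverse_real_of_nat)
  ultimately have "J u \<le> m + 0"
    by (rule LIMSEQ_le) (use s less_imp_le in blast)
  then have Ju: "J u \<le> J x" for x
    using m_le[of x] by simp
  have Re_eq: "Re (cinner x u) = Re (\<phi> x)" for x
  proof (rule ccontr)
    \<comment> \<open>\<open>- 2 * d\<close> is the derivative of \<open>J\<close> at
      \<open>u\<close> in direction \<open>x\<close>. For nonzero \<open>x\<close> the quadratic in
      \<open>t\<close> below takes the negative value \<open>- d\<^sup>2 / (norm x)\<^sup>2\<close>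
      at \<open>t = d / (norm x)\<^sup>2\<close>.\<close>
    define d where "d = Re (\<phi> x) - Re (cinner x u)"
    assume "\<not> ?thesis"
    then have d: "d \<noteq> 0"
      by (simp add: d_def)
    have comm: "Re (cinner u x) = Re (cinner x u)"
      by (subst cinner_commute) simp
    have var: "0 \<le> t\<^sup>2 * (norm x)\<^sup>2 - 2 * t * d" for t
      using Ju[of "u + t *\<^sub>R x"]
      by (simp add: J_def power2_norm_add add scaleR cinner_scaleR_right power_mult_distrib d_def
          comm algebra_simps)
    show False
    proof (cases "norm x = 0")
      case True
      then show ?thesis
        using var[of d] d by (simp add: power2_eq_square[symmetric])
    next
      case False
      then show ?thesis
        using var[of "d / (norm x)\<^sup>2"] d
        by (auto simp: power2_eq_square field_simps mult_le_0_iff split: if_splits)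
    qed
  qed
  have "\<phi> x = cinner x u" for x
  proof (rule complex_eqI)
    show "Re (\<phi> x) = Re (cinner x u)"
      by (simp add: Re_eq)
    \<comment> \<open>By complex homogeneity the imaginary part at \<open>x\<close> is minus the
      real part at \<open>\<i> *\<^sub>C x\<close>.\<close>
    show "Im (\<phi> x) = Im (cinner x u)"
      using Re_eq[of "\<i> *\<^sub>C x"] by (simp add: scale cinner_scaleC_left)
  qed
  then show ?thesis
    by blast
qed

subsection \<open>The normed algebra of bounded operators\<close>

lemma bop_eqI: "(\<And>x. bop_apply A x = bop_apply B x) \<Longrightarrow> A = B"
  by transfer (rule blinfun_eqI)

lemma bop_apply_zero [simp]: "bop_apply 0 x = 0"
  by transfer simp

lemma bop_apply_add [simp]: "bop_apply (A + B) x = bop_apply A x + bop_apply B x"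
  by transfer (simp add: blinfun.add_left)

lemma bop_apply_diff [simp]: "bop_apply (A - B) x = bop_apply A x - bop_apply B x"
  by transfer (simp add: blinfun.diff_left)

lemma bop_apply_minus [simp]: "bop_apply (- A) x = - bop_apply A x"
  by transfer (simp add: blinfun.minus_left)

lemma bop_apply_scaleR [simp]: "bop_apply (r *\<^sub>R A) x = r *\<^sub>R bop_apply A x"
  by transfer (simp add: blinfun.scaleR_left)

lemma bop_apply_scaleC [simp]: "bop_apply (c *\<^sub>C A) x = c *\<^sub>C bop_apply A x"
  by (simp add: bop_apply.rep_eq blinfun_apply_scaleC_bop)

lemma bop_apply_compose [simp]: "bop_apply (A o\<^sub>B B) x = bop_apply A (bop_apply B x)"
  by transfer simp

lemma bop_apply_sum: "bop_apply (\<Sum>i\<in>I. A i) x = (\<Sum>i\<in>I. bop_apply (A i) x)"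
  by (induction I rule: infinite_finite_induct) auto

lemma norm_bop_apply: "norm (bop_apply A x) \<le> norm A * norm x"
  by transfer (rule norm_blinfun)

lemma norm_bop_bound:
  assumes "0 \<le> b" "\<And>x. norm (bop_apply A x) \<le> b * norm x"
  shows "norm A \<le> b"
  using assms by transfer (rule norm_blinfun_bound)

lemma bounded_linear_bop_apply: "bounded_linear (bop_apply A)"
  by transfer (rule blinfun.bounded_linear_right)

lemma bop_apply_scaleC_right [simp]: "bop_apply A (c *\<^sub>C x) = c *\<^sub>C bop_apply A x"
  by transfer (simp add: clinear_iff)

lemmas bop_apply_right_simps [simp] =
  linear_add[OF bounded_linear.linear, OF bounded_linear_bop_apply]
  linear_diff[OF bounded_linear.linear, OF bounded_linear_bop_apply]
  linear_0[OF bounded_linear.linear, OF bounded_linear_bop_apply]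
  linear_neg[OF bounded_linear.linear, OF bounded_linear_bop_apply]
  linear_scale[OF bounded_linear.linear, OF bounded_linear_bop_apply]

lemmas bop_apply_sum_right = linear_sum[OF bounded_linear.linear, OF bounded_linear_bop_apply]

text \<open>Lets an operator be introduced by its values alone; strong limits and rank one operators
  enter through it.\<close>

lemma ex_bop:
  fixes f :: "'h::complex_normed_vector \<Rightarrow> 'h"
  assumes "\<And>x y. f (x + y) = f x + f y" "\<And>c x. f (c *\<^sub>C x) = c *\<^sub>C f x"
    "\<And>x. norm (f x) \<le> C * norm x"
  shows "\<exists>A. \<forall>x. bop_apply A x = f x"
proof -
  have bl: "bounded_linear f"
    using assms by (intro bounded_linear_intro[of _ C]) (auto simp: scaleR_scaleC mult.commute)
  have "bop_apply (Abs_bop (Blinfun f)) x = f x" for x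
    using assms by (subst bop_apply.rep_eq, subst Abs_bop_inverse)
      (auto simp: clinear_iff bounded_linear_Blinfun_apply bl)
  then show ?thesis
    by blast
qed

text \<open>Composition becomes multiplication so that ring simplification and the continuity of
  products apply to operators. The class is not \<open>ring_1\<close>: on the zero space the
  identity equals 0.\<close>

instantiation bop :: (complex_normed_vector) "{ring, monoid_mult, real_algebra}"
begin

definition times_bop :: "'a bop \<Rightarrow> 'a bop \<Rightarrow> 'a bop" where
  "times_bop A B = A o\<^sub>B B"

lift_definition one_bop :: "'a bop" is id_blinfun
  by (simp add: clinear_iff)

instance
proof
  have one: "bop_apply 1 x = x" for x :: 'a
    by transfer simp
  show "1 * A = A" "A * 1 = A" for A :: "'a bop"
    by (rule bop_eqI, simp add: times_bop_def one)+
qed (rule bop_eqI, simp add: times_bop_def)+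

end

lemma bop_apply_times [simp]: "bop_apply (A * B) x = bop_apply A (bop_apply B x)"
  by (simp add: times_bop_def)

lemma bop_apply_one [simp]: "bop_apply 1 x = x"
  by transfer simp

lemma norm_bop_times: "norm (A * B) \<le> norm A * norm (B :: 'a::complex_normed_vector bop)"
proof (rule norm_bop_bound)
  fix x
  show "norm (bop_apply (A * B) x) \<le> norm A * norm B * norm x"
    using order_trans[OF norm_bop_apply[of A "bop_apply B x"]
        mult_left_mono[OF norm_bop_apply[of B x]]]
    by (simp add: mult.assoc)
qed simp

instance bop :: (complex_normed_vector) real_normed_algebra
  by standard (rule norm_bop_times)

lemma norm_bop_one_le: "norm (1 :: 'a::complex_normed_vector bop) \<le> 1"
  by (rule norm_bop_bound) auto

lemma bop_scaleC_times [simp]: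
  fixes A B :: "'a::complex_normed_vector bop"
  shows "(c *\<^sub>C A) * B = c *\<^sub>C (A * B)" "A * (c *\<^sub>C B) = c *\<^sub>C (A * B)"
  by (rule bop_eqI, simp)+

section \<open>Pointwise limits and completeness\<close>

lemma bounded_linear_bop_apply_left: "bounded_linear (\<lambda>A. bop_apply A x)"
  by (rule bounded_linear_intro[of _ "norm x"]) (auto intro: order_trans[OF norm_bop_apply] simp: mult.commute)

text \<open>A sequence that is Cauchy at every vector is norm bounded by Banach-Steinhaus, so its
  pointwise limit is bounded again. Norm completeness, sums of blocks and strict completeness all
  start here.\<close>

lemma pointwise_limit_bop:
  fixes T :: "nat \<Rightarrow> 'h::chilbert_space bop"
  assumes "\<And>x. Cauchy (\<lambda>n. bop_apply (T n) x)"
  obtains A where "\<And>x. (\<lambda>n. bop_apply (T n) x) \<longlonglongrightarrow> bop_apply A x"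
proof -
  have "\<exists>c. \<forall>f\<in>range (\<lambda>n. bop_apply (T n)). norm (f x) \<le> c" for x
    using Cauchy_Bseq[OF assms[of x]] by (auto simp: Bseq_def)
  then obtain C where "\<And>f x. f \<in> range (\<lambda>n. bop_apply (T n)) \<Longrightarrow> norm (f x) \<le> C * norm x"
    using Banach_Steinhaus[of "range (\<lambda>n. bop_apply (T n))"] bounded_linear_bop_apply
    by (metis (no_types, lifting) imageE)
  then have C: "norm (bop_apply (T n) x) \<le> C * norm x" for n x
    by blast
  define f where "f x = lim (\<lambda>n. bop_apply (T n) x)" for x
  have f: "(\<lambda>n. bop_apply (T n) x) \<longlonglongrightarrow> f x" for x
    using assms[of x] by (simp add: f_def Cauchy_convergent_iff convergent_LIMSEQ_iff)
  have "\<exists>A. \<forall>x. bop_apply A x = f x"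
  proof (rule ex_bop)
    show "f (x + y) = f x + f y" for x y
      by (rule LIMSEQ_unique[OF f]) (auto intro!: tendsto_add f)
    show "f (c *\<^sub>C x) = c *\<^sub>C f x" for c x
      by (rule LIMSEQ_unique[OF f])
         (auto intro!: bounded_linear.tendsto[OF bounded_linear_scaleC] f)
    show "norm (f x) \<le> C * norm x" for x
      by (rule LIMSEQ_le_const2[OF tendsto_norm[OF f]]) (use C in blast)
  qed
  then obtain A where "\<forall>x. bop_apply A x = f x"
    by blast
  then show ?thesis
    using f by (intro that[of A]) simp
qed

lemma norm_le_of_pointwise_limit:
  assumes "(\<lambda>n. bop_apply (T n) x) \<longlonglongrightarrow> y" "\<And>n. n \<ge> N \<Longrightarrow> norm (bop_apply (T n) x) \<le> c"
  shows "norm y \<le> c"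
  by (rule LIMSEQ_le_const2[OF tendsto_norm[OF assms(1)]]) (use assms(2) in blast)

text \<open>Completeness serves twice: to sum the series for the dominating compact operator, and to
  apply \<open>Banach_Steinhaus\<close> to functionals on \<open>'h bop\<close>.\<close>

instance bop :: (chilbert_space) banach
proof
  fix T :: "nat \<Rightarrow> 'a bop"
  assume T: "Cauchy T"
  have "Cauchy (\<lambda>n. bop_apply (T n) x)" for x
    by (rule bounded_linear.Cauchy[OF bounded_linear_bop_apply_left T])
  then obtain A where A: "\<And>x. (\<lambda>n. bop_apply (T n) x) \<longlonglongrightarrow> bop_apply A x"
    using pointwise_limit_bop by blast
  have "T \<longlonglongrightarrow> A"
  proof (rule metric_LIMSEQ_I)
    fix e :: real
    assume e: "e > 0"
    then obtain N where N: "\<And>m n. m \<ge> N \<Longrightarrow> n \<ge> N \<Longrightarrow> norm (T m - T n) < e / 2"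
      using CauchyD[OF T, of "e / 2"] by auto
    have "norm (T n - A) \<le> e / 2" if "n \<ge> N" for n
    proof (rule norm_bop_bound)
      fix x
      have "(\<lambda>m. bop_apply (T n - T m) x) \<longlonglongrightarrow> bop_apply (T n - A) x"
        by (auto intro!: tendsto_intros A)
      then show "norm (bop_apply (T n - A) x) \<le> e / 2 * norm x"
      proof (rule norm_le_of_pointwise_limit)
        fix m
        assume "m \<ge> N"
        then have "norm (T n - T m) * norm x \<le> e / 2 * norm x"
          using N[OF that, of m] by (intro mult_right_mono) auto
        then show "norm (bop_apply (T n - T m) x) \<le> e / 2 * norm x"
          using norm_bop_apply order_trans by blast
      qed
    qed (use e in simp)
    then show "\<exists>N. \<forall>n\<ge>N. dist (T n) A < e"
      using e by (force simp: dist_norm)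
  qed
  then show "convergent T"
    by (auto simp: convergent_def)
qed

text \<open>A map on vectors rather than an element of \<open>bop\<close>: the strong* topology
  involves only the single values \<open>adj A v\<close>, which Riesz representation
  provides.\<close>

definition adj :: "'h::chilbert_space bop \<Rightarrow> 'h \<Rightarrow> 'h" where
  "adj A v = (SOME u. \<forall>x. cinner (bop_apply A x) v = cinner x u)"

lemma cinner_adj: "cinner (bop_apply A x) v = cinner x (adj A v)"
proof -
  have "\<exists>u. \<forall>x. cinner (bop_apply A x) v = cinner x u"
  proof (rule Riesz_representation)
    show "cmod (cinner (bop_apply A x) v) \<le> norm A * norm v * norm x" for x
    proof -
      have "cmod (cinner (bop_apply A x) v) \<le> norm (bop_apply A x) * norm v"
        by (rule cmod_cinner_le)
      also have "\<dots> \<le> norm A * norm x * norm v"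
        by (intro mult_right_mono norm_bop_apply) auto
      finally show ?thesis
        by (simp add: mult_ac)
    qed
  qed (auto simp: cinner_add_left cinner_scaleC_left)
  then show ?thesis
    unfolding adj_def by (rule someI2_ex) simp
qed

lemma adj_eqI: "(\<And>x. cinner (bop_apply A x) v = cinner x u) \<Longrightarrow> adj A v = u"
  by (rule cinner_ext) (simp add: cinner_adj)

lemma adj_diff: "adj (A - B) v = adj A v - adj B v"
  by (rule adj_eqI) (simp add: cinner_diff_left cinner_diff_right cinner_adj)

lemma adj_times: "adj (A * B) v = adj B (adj A v)"
  by (rule adj_eqI) (simp add: cinner_adj)

lemma adj_scaleR: "adj (r *\<^sub>R A) v = r *\<^sub>R adj A v"
  by (rule adj_eqI) (simp add: cinner_adj cinner_scaleR_left cinner_scaleR_right)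

subsection \<open>Projections onto finite orthonormal sets\<close>

definition rank1 :: "'h::chilbert_space \<Rightarrow> 'h \<Rightarrow> 'h bop" where
  "rank1 e v = (SOME A. \<forall>x. bop_apply A x = cinner x e *\<^sub>C v)"

lemma rank1_apply [simp]: "bop_apply (rank1 e v) x = cinner x e *\<^sub>C v"
proof -
  have "\<exists>A. \<forall>x. bop_apply A x = cinner x e *\<^sub>C v"
  proof (rule ex_bop)
    show "norm (cinner x e *\<^sub>C v) \<le> norm e * norm v * norm x" for x
      using mult_right_mono[OF cmod_cinner_le[of x e], of "norm v"]
      by (simp add: norm_scaleC mult_ac)
  qed (auto simp: cinner_add_left cinner_scaleC_left scaleC_add_left scaleC_scaleC)
  then show ?thesis
    unfolding rank1_def by (rule someI2_ex) simp
qed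

definition orthonormal :: "'h::complex_inner set \<Rightarrow> bool" where
  "orthonormal F \<longleftrightarrow> finite F \<and> (\<forall>e\<in>F. \<forall>e'\<in>F. cinner e e' = (if e = e' then 1 else 0))"

definition proj :: "'h::chilbert_space set \<Rightarrow> 'h bop" where
  "proj F = (\<Sum>e\<in>F. rank1 e e)"

lemma orthonormal_subset: "orthonormal G \<Longrightarrow> F \<subseteq> G \<Longrightarrow> orthonormal F"
  unfolding orthonormal_def by (meson finite_subset subsetD)

lemma proj_apply: "bop_apply (proj F) x = (\<Sum>e\<in>F. cinner x e *\<^sub>C e)"
  by (simp add: proj_def bop_apply_sum)

lemma proj_empty [simp]: "proj {} = 0"
  by (simp add: proj_def)

lemma proj_Diff: "finite G \<Longrightarrow> F \<subseteq> G \<Longrightarrow> proj (G - F) = proj G - proj F"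
  by (simp add: proj_def sum_diff)

lemma cinner_proj: "cinner (bop_apply (proj F) x) y = cinner x (bop_apply (proj F) y)"
proof -
  have "cinner x e * cinner e y = cnj (cinner y e) * cinner x e" for e
    using cinner_commute[of e y] by simp
  then show ?thesis
    by (simp only: proj_apply cinner_sum_left cinner_sum_right cinner_scaleC_left
        cinner_scaleC_right)
qed

lemma adj_proj [simp]: "adj (proj F) v = bop_apply (proj F) v"
  by (rule adj_eqI) (rule cinner_proj)

lemma proj_basis:
  assumes "orthonormal G" "F \<subseteq> G" "e \<in> G"
  shows "bop_apply (proj F) e = (if e \<in> F then e else 0)"
proof -
  have "finite F"
    using assms by (meson orthonormal_def finite_subset)
  moreover have "cinner e e' *\<^sub>C e' = (if e = e' then e' else 0)" if "e' \<in> F" for e'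
    using assms that by (auto simp: orthonormal_def scaleC_one)
  ultimately show ?thesis
    by (simp add: proj_apply cong: sum.cong)
qed

text \<open>Inside one orthonormal set projections multiply as sets intersect, which turns the later
  operator algebra into set computations. The ambient set \<open>H\<close> matters: projections onto
  unrelated orthonormal sets need not even commute.\<close>

lemma proj_times:
  assumes "orthonormal H" "F \<subseteq> H" "G \<subseteq> H"
  shows "proj F * proj G = proj (F \<inter> G)"
proof (rule bop_eqI)
  fix x
  have fin: "finite G"
    using assms by (meson orthonormal_def finite_subset)
  have "bop_apply (proj F) (bop_apply (proj G) x)
      = (\<Sum>e\<in>G. cinner x e *\<^sub>C bop_apply (proj F) e)"
    unfolding proj_apply[of G] by (simp add: bop_apply_sum_right)
  also have "\<dots> = (\<Sum>e\<in>G. if e \<in> F then cinner x e *\<^sub>C e else 0)"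
    using assms by (intro sum.cong) (auto simp: proj_basis[OF assms(1,2)] scaleC_zero)
  also have "\<dots> = bop_apply (proj (F \<inter> G)) x"
    unfolding proj_apply using sum.inter_restrict[OF fin, of "\<lambda>e. cinner x e *\<^sub>C e" F]
    by (simp add: Int_commute)
  finally show "bop_apply (proj F * proj G) x = bop_apply (proj (F \<inter> G)) x"
    by simp
qed

lemma proj_idem: "orthonormal F \<Longrightarrow> proj F * proj F = proj F"
  using proj_times[of F F F] by simp

lemma power2_norm_proj:
  assumes "orthonormal F"
  shows "(norm (bop_apply (proj F) x))\<^sup>2 = Re (cinner x (bop_apply (proj F) x))"
  using proj_idem[OF assms] by (metis bop_apply_times cinner_proj power2_norm_eq_cinner)

lemma norm_proj_apply_le:
  assumes "orthonormal F"
  shows "norm (bop_apply (proj F) x) \<le> norm x"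
proof -
  let ?y = "bop_apply (proj F) x"
  have "(norm ?y)\<^sup>2 \<le> norm x * norm ?y"
    unfolding power2_norm_proj[OF assms]
    using complex_Re_le_cmod cmod_cinner_le order_trans by blast
  then show ?thesis
    by (metis mult_le_cancel_right norm_ge_zero order_antisym_conv power2_eq_square linorder_not_less
        order_refl)
qed

lemma norm_proj_le: "orthonormal F \<Longrightarrow> norm (proj F) \<le> 1"
  by (rule norm_bop_bound) (auto intro: norm_proj_apply_le)

text \<open>One Gram-Schmidt step: the residual \<open>w\<close> is orthogonal to \<open>F\<close>
  and, unless it is 0, is normalized and added.\<close>

lemma orthonormal_extend1:
  fixes v :: "'h::chilbert_space"
  assumes "orthonormal F"
  shows "\<exists>G. orthonormal G \<and> F \<subseteq> G \<and> bop_apply (proj G) v = v"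
proof -
  define w where "w = v - bop_apply (proj F) v"
  show ?thesis
  proof (cases "w = 0")
    case True
    then show ?thesis
      using assms by (auto simp: w_def)
  next
    case False
    define e where "e = (1 / norm w) *\<^sub>R w"
    have we: "cinner w e' = 0" "cinner e' w = 0" if "e' \<in> F" for e'
    proof -
      have "cinner w e' = cinner v e' - cinner v (bop_apply (proj F) e')"
        by (simp add: w_def cinner_diff_left cinner_proj)
      then show 1: "cinner w e' = 0"
        using proj_basis[OF assms order_refl that] that by simp
      then show "cinner e' w = 0"
        by (subst cinner_commute) simp
    qed
    have ee: "cinner e e = 1"
      using False by (simp add: cinner_self) (simp add: e_def)
    have eF: "cinner e e' = 0" "cinner e' e = 0" if "e' \<in> F" for e'
      using we[OF that] by (simp_all add: e_def cinner_scaleR_left cinner_scaleR_right)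
    then have on: "orthonormal (insert e F)"
      using assms ee by (auto simp: orthonormal_def)
    have eF': "e \<notin> F"
      using eF[of e] ee by auto
    have "cinner (bop_apply (proj F) v) e = 0"
      using we by (simp add: proj_apply cinner_sum_left cinner_scaleC_left e_def
          cinner_scaleR_right)
    then have "cinner v e = cinner w e"
      by (simp add: w_def cinner_diff_left)
    also have "cinner w e = of_real (norm w)"
      using False by (simp add: e_def cinner_scaleR_right cinner_self[of w] power2_eq_square)
    finally have "cinner v e *\<^sub>C e = norm w *\<^sub>R e"
      by (simp add: scaleR_scaleC)
    then have "cinner v e *\<^sub>C e = w"
      using False by (simp add: e_def)
    with eF' have "bop_apply (proj (insert e F)) v = v"
      using assms by (simp add: proj_apply orthonormal_def w_def)
    then show ?thesis
      using on by blast
  qed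
qed

lemma proj_fixed_mono:
  assumes "orthonormal G" "F \<subseteq> G" "bop_apply (proj F) v = v"
  shows "bop_apply (proj G) v = v"
  using proj_times[OF assms(1) order_refl assms(2)] assms(2,3)
  by (metis Int_absorb1 bop_apply_times)

text \<open>Being fixed by \<open>proj G\<close> stands for membership in the span of
  \<open>G\<close>, so no spans are formed.\<close>

lemma orthonormal_extend:
  fixes F V :: "'h::chilbert_space set"
  assumes "finite V" "orthonormal F"
  shows "\<exists>G. orthonormal G \<and> F \<subseteq> G \<and> (\<forall>v\<in>V. bop_apply (proj G) v = v)"
  using assms
proof (induction V)
  case (insert v V)
  then obtain G where G: "orthonormal G" "F \<subseteq> G" "\<forall>v\<in>V. bop_apply (proj G) v = v"
    by blast
  obtain H where "orthonormal H" "G \<subseteq> H" "bop_apply (proj H) v = v"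
    using orthonormal_extend1[OF G(1)] by blast
  then show ?case
    using G proj_fixed_mono[of H G] by (intro exI[of _ H]) auto
qed auto

subsection \<open>Compact operators\<close>

lemma compact_bopI:
  assumes "bop_apply B ` cball 0 1 \<subseteq> T" "compact T"
  shows "compact_bop B"
  unfolding compact_bop_def using assms
  by (metis closed_closure closure_minimal compact_Int_closed compact_imp_closed inf.absorb_iff2)

text \<open>Total boundedness, the closure being complete. The points of the net are the finitely
  many vectors at which other operators will be tested.\<close>

lemma compact_bop_iff_net:
  fixes B :: "'h::chilbert_space bop"
  shows "compact_bop B \<longleftrightarrow>
    (\<forall>e>0. \<exists>W. finite W \<and> (\<forall>x. norm x \<le> 1 \<longrightarrow> (\<exists>w\<in>W. norm (bop_apply B x - w) < e)))"
    (is "_ \<longleftrightarrow> ?R")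
proof
  assume B: "compact_bop B"
  show ?R
  proof (intro allI impI)
    fix e :: real
    assume "e > 0"
    then obtain W where W: "finite W" "closure (bop_apply B ` cball 0 1) \<subseteq> (\<Union>w\<in>W. ball w e)"
      using B unfolding compact_bop_def compact_eq_totally_bounded by blast
    have "\<exists>w\<in>W. norm (bop_apply B x - w) < e" if "norm x \<le> 1" for x
    proof -
      have "bop_apply B x \<in> closure (bop_apply B ` cball 0 1)"
        using that by (intro subsetD[OF closure_subset]) auto
      then obtain w where "w \<in> W" "dist w (bop_apply B x) < e"
        using W(2) by fastforce
      then show ?thesis
        by (auto simp: dist_norm norm_minus_commute)
    qed
    with W(1) show "\<exists>W. finite W \<and> (\<forall>x. norm x \<le> 1 \<longrightarrow> (\<exists>w\<in>W. norm (bop_apply B x - w) < e))"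
      by blast
  qed
next
  assume R: ?R
  show "compact_bop B"
    unfolding compact_bop_def compact_eq_totally_bounded
  proof (intro conjI allI impI)
    show "complete (closure (bop_apply B ` cball 0 1))"
      by (simp add: complete_eq_closed)
    fix e :: real
    assume e: "e > 0"
    then obtain W where W: "finite W"
      "\<And>x. norm x \<le> 1 \<Longrightarrow> \<exists>w\<in>W. norm (bop_apply B x - w) < e / 2"
      using R half_gt_zero by metis
    \<comment> \<open>Closed balls of half the radius contain the closure too, and still fit into
      the open balls of radius \<open>e\<close>.\<close>
    have "bop_apply B ` cball 0 1 \<subseteq> (\<Union>w\<in>W. cball w (e / 2))"
      using W(2) by (fastforce simp: dist_norm norm_minus_commute)
    then have "closure (bop_apply B ` cball 0 1) \<subseteq> (\<Union>w\<in>W. cball w (e / 2))"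
      using W(1) by (intro closure_minimal) auto
    also have "\<dots> \<subseteq> (\<Union>w\<in>W. ball w e)"
      using e by (auto intro!: UN_mono)
    finally show "\<exists>W. finite W \<and> closure (bop_apply B ` cball 0 1) \<subseteq> (\<Union>w\<in>W. ball w e)"
      using W(1) by blast
  qed
qed

lemma compact_bop_zero: "compact_bop (0 :: 'h::chilbert_space bop)"
  by (rule compact_bopI[of _ "{0}"]) auto

lemma compact_bop_add:
  fixes A B :: "'h::chilbert_space bop"
  assumes "compact_bop A" "compact_bop B"
  shows "compact_bop (A + B)"
proof (rule compact_bopI)
  let ?S = "closure (bop_apply A ` cball 0 1)" and ?T = "closure (bop_apply B ` cball 0 1)"
  show "compact {x + y | x y. x \<in> ?S \<and> y \<in> ?T}"
    using assms by (intro compact_sums) (auto simp: compact_bop_def)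
  show "bop_apply (A + B) ` cball 0 1 \<subseteq> {x + y | x y. x \<in> ?S \<and> y \<in> ?T}"
    using closure_subset[of "bop_apply A ` cball 0 1"] closure_subset[of "bop_apply B ` cball 0 1"]
    by fastforce
qed

lemma compact_bop_sum:
  fixes A :: "'i \<Rightarrow> 'h::chilbert_space bop"
  assumes "\<And>i. i \<in> I \<Longrightarrow> compact_bop (A i)"
  shows "compact_bop (\<Sum>i\<in>I. A i)"
  using assms
  by (induction I rule: infinite_finite_induct) (auto intro: compact_bop_zero compact_bop_add)

text \<open>The image of the unit ball lies on the complex line through \<open>v\<close>, in the
  continuous image of a disc. The factor \<open>c\<close> makes scaled projections finite sums of
  such operators.\<close>

lemma compact_bop_rank1: "compact_bop (c *\<^sub>C rank1 e v)"
proof (rule compact_bopI)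
  have "continuous_on UNIV (\<lambda>c. c *\<^sub>C v)"
    by (intro linear_continuous_on bounded_linear_intro[of _ "norm v"])
       (auto simp: scaleC_add_left scaleR_scaleC scaleC_scaleC norm_scaleC scaleC_complex_def)
  then show "compact ((\<lambda>c. c *\<^sub>C v) ` cball 0 (cmod c * norm e))"
    by (intro compact_continuous_image) (auto intro: continuous_on_subset)
  show "bop_apply (c *\<^sub>C rank1 e v) ` cball 0 1 \<subseteq> (\<lambda>c. c *\<^sub>C v) ` cball 0 (cmod c * norm e)"
  proof clarsimp
    fix x :: 'a
    assume "norm x \<le> 1"
    then have "cmod (c * cinner x e) \<le> cmod c * norm e"
      using cmod_cinner_le[of x e] mult_right_mono[of "norm x" 1 "norm e"]
      by (auto simp: norm_mult intro!: mult_left_mono)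
    then show "c *\<^sub>C cinner x e *\<^sub>C v \<in> (\<lambda>c. c *\<^sub>C v) ` cball 0 (cmod c * norm e)"
      by (auto simp: scaleC_scaleC)
  qed
qed

lemma compact_bop_scaleR_proj: "compact_bop (r *\<^sub>R proj F)"
  unfolding proj_def scaleR_sum_right
  unfolding scaleR_scaleC
  by (intro compact_bop_sum compact_bop_rank1)

lemma compact_bop_LIMSEQ:
  fixes B :: "'h::chilbert_space bop"
  assumes "\<And>n. compact_bop (T n)" "T \<longlonglongrightarrow> B"
  shows "compact_bop B"
  unfolding compact_bop_iff_net
proof (intro allI impI)
  fix e :: real
  assume "e > 0"
  then obtain n where n: "norm (T n - B) < e / 2"
    using LIMSEQ_D[OF assms(2), of "e / 2"] by auto
  obtain W where W: "finite W" "\<And>x. norm x \<le> 1 \<Longrightarrow> \<exists>w\<in>W. norm (bop_apply (T n) x - w) < e / 2"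
    using assms(1)[of n] \<open>e > 0\<close> half_gt_zero unfolding compact_bop_iff_net by metis
  have "\<exists>w\<in>W. norm (bop_apply B x - w) < e" if x: "norm x \<le> 1" for x
  proof -
    obtain w where w: "w \<in> W" "norm (bop_apply (T n) x - w) < e / 2"
      using W(2)[OF x] by blast
    have "norm (bop_apply (T n - B) x) \<le> norm (T n - B) * norm x"
      by (rule norm_bop_apply)
    also have "\<dots> \<le> norm (T n - B)"
      using x by (simp add: mult_left_le)
    finally have "norm (bop_apply (T n) x - bop_apply B x) < e / 2"
      using n by simp
    then have "norm (bop_apply B x - w) < e / 2 + e / 2"
      using norm_triangle_ineq4[of "bop_apply (T n) x - w" "bop_apply (T n) x - bop_apply B x"] w(2)
      by simp
    then show ?thesis
      using w(1) by auto
  qed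
  then show "\<exists>W. finite W \<and> (\<forall>x. norm x \<le> 1 \<longrightarrow> (\<exists>w\<in>W. norm (bop_apply B x - w) < e))"
    using W(1) by blast
qed

subsection \<open>Topologies generated by seminorms\<close>

lemma cseminorm_triangle: "cseminorm p \<Longrightarrow> p (x + y) \<le> p x + p y"
  by (simp add: cseminorm_def)

lemma cseminorm_scaleC: "cseminorm p \<Longrightarrow> p (c *\<^sub>C x) = cmod c * p x"
  by (simp add: cseminorm_def)

lemma cseminorm_scaleR: "cseminorm p \<Longrightarrow> p (r *\<^sub>R x) = \<bar>r\<bar> * p x"
  by (simp add: scaleR_scaleC cseminorm_scaleC)

lemma cseminorm_zero: "cseminorm p \<Longrightarrow> p 0 = 0"
  using cseminorm_scaleC[of p 0 0] by simp

lemma cseminorm_minus: "cseminorm p \<Longrightarrow> p (- x) = p x"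
  using cseminorm_scaleR[of p "-1" x] by simp

lemma cseminorm_diff_commute: "cseminorm p \<Longrightarrow> p (x - y) = p (y - x)"
  using cseminorm_minus[of p "x - y"] by simp

lemma cseminorm_nonneg: "cseminorm p \<Longrightarrow> 0 \<le> p x"
  using cseminorm_triangle[of p x "- x"] by (simp add: cseminorm_zero cseminorm_minus)

lemma cseminorm_reverse_triangle: "cseminorm p \<Longrightarrow> \<bar>p y - p x\<bar> \<le> p (y - x)"
  using cseminorm_triangle[of p "y - x" x] cseminorm_triangle[of p "x - y" y]
  by (simp add: cseminorm_diff_commute)

lemma cseminorm_cmod:
  assumes "clinear f"
  shows "cseminorm (\<lambda>x. cmod (f x))"
  using assms
  by (auto simp: cseminorm_def clinear_iff norm_triangle_ineq norm_mult scaleC_complex_def)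

definition seminorm_ball :: "('a::complex_vector \<Rightarrow> real) set \<Rightarrow> 'a \<Rightarrow> real \<Rightarrow> 'a set" where
  "seminorm_ball Q x e = {y. \<forall>q\<in>Q. q (y - x) < e}"

context
  fixes P :: "('a::complex_vector \<Rightarrow> real) set"
  assumes P: "\<And>p. p \<in> P \<Longrightarrow> cseminorm p" and ne: "P \<noteq> {}"
begin

lemma topspace_seminorm_topology: "topspace (seminorm_topology P) = UNIV"
proof -
  obtain p where "p \<in> P"
    using ne by blast
  then have "x \<in> {y. p (y - x) < 1} \<and> {y. p (y - x) < 1} \<in> {{y. p (y - x) < e} |p x e. p \<in> P \<and> 0 < e}"
    for x
    using cseminorm_zero[OF P] by force
  then show ?thesis
    unfolding seminorm_topology_def topology_generated_by_topspace by blast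
qed

lemma openin_seminorm_ball:
  assumes "finite Q" "Q \<subseteq> P" "e > 0"
  shows "openin (seminorm_topology P) (seminorm_ball Q x e)"
  using assms
proof (induction Q)
  case empty
  then show ?case
    using openin_topspace[of "seminorm_topology P"]
    by (simp add: seminorm_ball_def topspace_seminorm_topology)
next
  case (insert q Q)
  have "openin (seminorm_topology P) {y. q (y - x) < e}"
    unfolding seminorm_topology_def
    using insert by (intro topology_generated_by_Basis) auto
  moreover have "seminorm_ball (insert q Q) x e = {y. q (y - x) < e} \<inter> seminorm_ball Q x e"
    by (auto simp: seminorm_ball_def)
  ultimately show ?case
    using insert by auto
qed

lemma mem_seminorm_ball: "Q \<subseteq> P \<Longrightarrow> e > 0 \<Longrightarrow> x \<in> seminorm_ball Q x e"
  using P by (fastforce simp: seminorm_ball_def cseminorm_zero)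

text \<open>The generating sets are balls about arbitrary centres. The triangle inequality recentres
  them at any of their points, so balls about the point itself form a neighbourhood base.\<close>

lemma openin_seminorm_topology_iff:
  "openin (seminorm_topology P) U \<longleftrightarrow>
    (\<forall>x\<in>U. \<exists>Q e. finite Q \<and> Q \<subseteq> P \<and> e > 0 \<and> seminorm_ball Q x e \<subseteq> U)" (is "?L \<longleftrightarrow> ?R U")
proof
  assume ?L
  then have "generate_topology_on {{y. p (y - x) < e} |p x e. p \<in> P \<and> 0 < e} U"
    by (simp add: seminorm_topology_def openin_topology_generated_by_iff)
  then show "?R U"
  proof induction
    case (Int a b)
    show ?case
    proof
      fix x
      assume "x \<in> a \<inter> b"
      with Int obtain Q e Q' e' where *: "finite Q" "Q \<subseteq> P" "e > 0" "seminorm_ball Q x e \<subseteq> a"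
        "finite Q'" "Q' \<subseteq> P" "e' > 0" "seminorm_ball Q' x e' \<subseteq> b"
        by (meson IntE)
      then have "seminorm_ball (Q \<union> Q') x (min e e') \<subseteq> a \<inter> b"
        by (fastforce simp: seminorm_ball_def)
      with * show "\<exists>Q e. finite Q \<and> Q \<subseteq> P \<and> e > 0 \<and> seminorm_ball Q x e \<subseteq> a \<inter> b"
        by (intro exI[of _ "Q \<union> Q'"] exI[of _ "min e e'"]) auto
    qed
  next
    case (UN K)
    then show ?case
      by (meson Union_iff Union_upper order_trans)
  next
    case (Basis s)
    then obtain p x e where s: "s = {y. p (y - x) < e}" "p \<in> P" "e > 0"
      by blast
    show ?case
    proof
      fix z
      assume z: "z \<in> s"
      have "seminorm_ball {p} z (e - p (z - x)) \<subseteq> s"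
        using cseminorm_triangle[OF P[OF s(2)], of _ "z - x"]
        by (auto simp: seminorm_ball_def s) (metis add_diff_eq diff_add_cancel less_diff_eq order_le_less_trans)
      then show "\<exists>Q e. finite Q \<and> Q \<subseteq> P \<and> e > 0 \<and> seminorm_ball Q z e \<subseteq> s"
        using z s by (intro exI[of _ "{p}"] exI[of _ "e - p (z - x)"]) auto
    qed
  qed auto
next
  assume "?R U"
  then show ?L
    by (subst openin_subopen) (meson openin_seminorm_ball mem_seminorm_ball)
qed

lemma locally_convex_seminorm_topology: "locally_convex_space (seminorm_topology P)"
  unfolding locally_convex_space_def
proof (intro conjI allI impI)
  let ?T = "seminorm_topology P"
  show "topspace ?T = UNIV"
    by (rule topspace_seminorm_topology)
  show "continuous_map (prod_topology ?T ?T) ?T (\<lambda>(x, y). x + y)"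
    unfolding continuous_map_def
  proof (intro conjI allI impI)
    fix U
    assume U: "openin ?T U"
    show "openin (prod_topology ?T ?T)
        {z \<in> topspace (prod_topology ?T ?T). (case z of (x, y) \<Rightarrow> x + y) \<in> U}"
      unfolding openin_prod_topology_alt
    proof (intro allI impI)
      fix x y
      assume "(x, y) \<in> {z \<in> topspace (prod_topology ?T ?T). (case z of (x, y) \<Rightarrow> x + y) \<in> U}"
      then obtain Q e where Q: "finite Q" "Q \<subseteq> P" "e > 0" "seminorm_ball Q (x + y) e \<subseteq> U"
        using U by (auto simp: openin_seminorm_topology_iff)
      have "x' + y' \<in> U" if "x' \<in> seminorm_ball Q x (e / 2)" "y' \<in> seminorm_ball Q y (e / 2)"
        for x' y'
      proof -
        have "q (x' + y' - (x + y)) < e" if "q \<in> Q" for q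
        proof -
          have "q (x' + y' - (x + y)) \<le> q (x' - x) + q (y' - y)"
            using that Q(2) cseminorm_triangle[OF P, of q "x' - x" "y' - y"]
            by (auto simp: algebra_simps)
          also have "\<dots> < e / 2 + e / 2"
            using that \<open>x' \<in> _\<close> \<open>y' \<in> _\<close> by (intro add_strict_mono) (auto simp: seminorm_ball_def)
          finally show ?thesis
            by simp
        qed
        then show ?thesis
          using Q(4) by (auto simp: seminorm_ball_def)
      qed
      then show "\<exists>V W. openin ?T V \<and> openin ?T W \<and> x \<in> V \<and> y \<in> W \<and>
          V \<times> W \<subseteq> {z \<in> topspace (prod_topology ?T ?T). (case z of (x, y) \<Rightarrow> x + y) \<in> U}"
        using Q
        by (intro exI[of _ "seminorm_ball Q x (e / 2)"] exI[of _ "seminorm_ball Q y (e / 2)"])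
           (auto simp: openin_seminorm_ball mem_seminorm_ball topspace_seminorm_topology)
    qed
  qed (auto simp: topspace_seminorm_topology)
  show "continuous_map (prod_topology euclidean ?T) ?T (\<lambda>(c, x). c *\<^sub>C x)"
    unfolding continuous_map_def
  proof (intro conjI allI impI)
    fix U
    assume U: "openin ?T U"
    show "openin (prod_topology euclidean ?T)
        {z \<in> topspace (prod_topology euclidean ?T). (case z of (c, x) \<Rightarrow> c *\<^sub>C x) \<in> U}"
      unfolding openin_prod_topology_alt
    proof (intro allI impI)
      fix c x
      assume "(c, x) \<in> {z \<in> topspace (prod_topology euclidean ?T). (case z of (c, x) \<Rightarrow> c *\<^sub>C x) \<in> U}"
      then obtain Q e where Q: "finite Q" "Q \<subseteq> P" "e > 0" "seminorm_ball Q (c *\<^sub>C x) e \<subseteq> U"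
        using U by (auto simp: openin_seminorm_topology_iff)
      define M where "M = (\<Sum>q\<in>Q. q x)"
      have M: "q x \<le> M" if "q \<in> Q" for q
        unfolding M_def using that Q(1) P Q(2) cseminorm_nonneg by (intro member_le_sum) blast+
      have M0: "M \<ge> 0"
        unfolding M_def using P Q(2) cseminorm_nonneg by (intro sum_nonneg) blast
      \<comment> \<open>The bound to reach is \<open>(cmod c + 1) * s + r * (M + 1) \<le> e\<close>.
        Keeping \<open>r\<close> below 1 ensures \<open>cmod d \<le> cmod c + 1\<close>, and
        \<open>M + 1\<close> avoids division by 0.\<close>
      define r where "r = min 1 (e / 2 / (M + 1))"
      define s where "s = e / 2 / (cmod c + 1)"
      have r: "r > 0" "s > 0"
        using Q(3) M0 by (auto simp: r_def s_def add_nonneg_pos)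
      have "d *\<^sub>C y \<in> U" if d: "d \<in> ball c r" and y: "y \<in> seminorm_ball Q x s" for d y
      proof -
        have "q (d *\<^sub>C y - c *\<^sub>C x) < e" if q: "q \<in> Q" for q
        proof -
          have qn: "cseminorm q"
            using q Q P by blast
          have "d *\<^sub>C y - c *\<^sub>C x = d *\<^sub>C (y - x) + (d - c) *\<^sub>C x"
            using scaleC_add_left[of "d - c" c x] by (simp add: scaleC_diff)
          then have "q (d *\<^sub>C y - c *\<^sub>C x) \<le> cmod d * q (y - x) + cmod (d - c) * q x"
            by (metis cseminorm_triangle[OF qn] cseminorm_scaleC[OF qn])
          moreover have "cmod d * q (y - x) + cmod (d - c) * q x < (cmod c + 1) * s + r * (M + 1)"
          proof (rule add_le_less_mono)
            have "cmod d \<le> cmod c + 1"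
              using d norm_triangle_ineq2[of d c] by (simp add: dist_norm norm_minus_commute r_def)
            moreover have "q (y - x) \<le> s"
              using y q by (auto simp: seminorm_ball_def less_imp_le)
            ultimately show "cmod d * q (y - x) \<le> (cmod c + 1) * s"
              using cseminorm_nonneg[OF qn] by (intro mult_mono) auto
            have "cmod (d - c) * q x \<le> r * M"
              using d M[OF q] cseminorm_nonneg[OF qn] r
              by (intro mult_mono) (auto simp: dist_norm norm_minus_commute)
            then show "cmod (d - c) * q x < r * (M + 1)"
              using r by (simp add: distrib_left)
          qed
          moreover have "(cmod c + 1) * s + r * (M + 1) \<le> e / 2 + e / 2"
          proof (rule add_mono)
            show "(cmod c + 1) * s \<le> e / 2"
            proof -
              have "cmod c + 1 \<noteq> 0"
                using norm_ge_zero[of c] by linarith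
              then have "s * (cmod c + 1) = e / 2"
                using s_def by (metis nonzero_eq_divide_eq)
              then show ?thesis
                by (simp add: mult.commute)
            qed
            have "r * (M + 1) \<le> e / 2 / (M + 1) * (M + 1)"
              using M0 by (intro mult_right_mono) (auto simp: r_def)
            also have "\<dots> = e / 2"
              by (subst nonzero_eq_divide_eq[symmetric]) (use M0 in auto)
            finally show "r * (M + 1) \<le> e / 2" .
          qed
          ultimately show ?thesis
            by linarith
        qed
        then show ?thesis
          using Q(4) by (auto simp: seminorm_ball_def)
      qed
      then show "\<exists>V W. openin euclidean V \<and> openin ?T W \<and> c \<in> V \<and> x \<in> W \<and>
          V \<times> W \<subseteq> {z \<in> topspace (prod_topology euclidean ?T). (case z of (c, x) \<Rightarrow> c *\<^sub>C x) \<in> U}"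
        using Q r
        by (intro exI[of _ "ball c r"] exI[of _ "seminorm_ball Q x s"])
           (auto simp: openin_seminorm_ball mem_seminorm_ball topspace_seminorm_topology)
    qed
  qed (auto simp: topspace_seminorm_topology)
  fix U
  assume U: "openin ?T U \<and> 0 \<in> U"
  then obtain Q e where Q: "finite Q" "Q \<subseteq> P" "e > 0" "seminorm_ball Q 0 e \<subseteq> U"
    by (auto simp: openin_seminorm_topology_iff)
  have "convex (seminorm_ball Q 0 e)"
  proof (rule convexI)
    fix x y and u v :: real
    assume xy: "x \<in> seminorm_ball Q 0 e" "y \<in> seminorm_ball Q 0 e" and uv: "0 \<le> u" "0 \<le> v" "u + v = 1"
    have "q (u *\<^sub>R x + v *\<^sub>R y) < e" if q: "q \<in> Q" for q
    proof -
      have qn: "cseminorm q"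
        using q Q P by blast
      have "q (u *\<^sub>R x + v *\<^sub>R y) \<le> u * q x + v * q y"
        using cseminorm_triangle[OF qn, of "u *\<^sub>R x" "v *\<^sub>R y"] uv
        by (simp add: cseminorm_scaleR[OF qn])
      also have "\<dots> < e"
        using xy uv q by (intro convex_bound_lt) (auto simp: seminorm_ball_def)
      finally show ?thesis .
    qed
    then show "u *\<^sub>R x + v *\<^sub>R y \<in> seminorm_ball Q 0 e"
      by (simp add: seminorm_ball_def)
  qed
  then show "\<exists>V. openin ?T V \<and> 0 \<in> V \<and> convex V \<and> V \<subseteq> U"
    using Q by (intro exI[of _ "seminorm_ball Q 0 e"])
      (simp add: openin_seminorm_ball mem_seminorm_ball)
qed

text \<open>Continuity at 0 gives a ball on which \<open>p\<close> is below 1; homogeneity spreads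
  this to all vectors.\<close>

lemma continuous_seminorm_bound:
  assumes p: "cseminorm p" and cont: "continuous_map (seminorm_topology P) euclidean p"
  shows "\<exists>Q C. finite Q \<and> Q \<subseteq> P \<and> 0 \<le> C \<and> (\<forall>x. p x \<le> C * (\<Sum>q\<in>Q. q x))"
proof -
  have "openin (seminorm_topology P) {x \<in> topspace (seminorm_topology P). p x \<in> {..<1}}"
    by (rule openin_continuous_map_preimage[OF cont]) simp
  then have "openin (seminorm_topology P) {x. p x < 1}"
    by (simp add: topspace_seminorm_topology)
  moreover have "0 \<in> {x. p x < 1}"
    by (simp add: cseminorm_zero[OF p])
  ultimately obtain Q e where Q: "finite Q" "Q \<subseteq> P" "e > 0" "seminorm_ball Q 0 e \<subseteq> {x. p x < 1}"
    by (meson openin_seminorm_topology_iff)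
  have "p x \<le> 1 / e * (\<Sum>q\<in>Q. q x)" for x
  proof (rule field_le_epsilon)
    fix d :: real
    assume d: "d > 0"
    \<comment> \<open>The summand \<open>d * e\<close> keeps \<open>t\<close> positive when all
      \<open>q x\<close> vanish, so that \<open>x\<close> can be rescaled into the ball.\<close>
    define t where "t = (\<Sum>q\<in>Q. q x) + d * e"
    have q0: "0 \<le> q x" if "q \<in> Q" for q
      by (meson P Q(2) cseminorm_nonneg subsetD that)
    have q: "q x < t" if "q \<in> Q" for q
    proof -
      have "q x \<le> (\<Sum>q\<in>Q. q x)"
        using that Q(1) q0 by (intro member_le_sum) auto
      moreover have "d * e > 0"
        using d Q(3) by simp
      ultimately show ?thesis
        by (simp add: t_def)
    qed
    have t: "t > 0"
      unfolding t_def using d Q(3) q0 by (intro add_nonneg_pos sum_nonneg) auto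
    have "(e / t) *\<^sub>R x \<in> seminorm_ball Q 0 e"
      unfolding seminorm_ball_def
    proof safe
      fix q
      assume "q \<in> Q"
      then have "cseminorm q"
        using P Q(2) by blast
      then have "q ((e / t) *\<^sub>R x) = e / t * q x"
        using t Q(3) by (simp add: cseminorm_scaleR)
      also have "\<dots> < e"
        using q[OF \<open>q \<in> Q\<close>] t Q(3) by (simp add: field_simps)
      finally show "q ((e / t) *\<^sub>R x - 0) < e"
        by simp
    qed
    then have "e / t * p x < 1"
      using Q(3,4) t by (auto simp: cseminorm_scaleR[OF p])
    then have "p x < t / e"
      using t Q(3) by (simp add: field_simps)
    then show "p x \<le> 1 / e * (\<Sum>q\<in>Q. q x) + d"
      using Q(3) by (simp add: t_def field_simps)
  qed
  then show ?thesis
    using Q by (intro exI[of _ Q] exI[of _ "1 / e"]) auto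
qed

lemma seminorm_continuous_of_bound:
  assumes p: "cseminorm p" and Q: "finite Q" "Q \<subseteq> P" and C: "0 \<le> C"
    and le: "\<And>x. p x \<le> C * (\<Sum>q\<in>Q. q x)"
  shows "continuous_map (seminorm_topology P) euclidean p"
  unfolding continuous_map_def
proof (intro conjI allI impI)
  fix U :: "real set"
  assume "openin euclidean U"
  then have U: "open U"
    by simp
  show "openin (seminorm_topology P) {x \<in> topspace (seminorm_topology P). p x \<in> U}"
    unfolding openin_seminorm_topology_iff
  proof
    fix x
    assume "x \<in> {x \<in> topspace (seminorm_topology P). p x \<in> U}"
    then obtain e where e: "e > 0" "\<And>t. \<bar>t - p x\<bar> < e \<Longrightarrow> t \<in> U"
      using U by (auto simp: open_dist dist_real_def)
    \<comment> \<open>The added 1 covers \<open>C = 0\<close> and empty \<open>Q\<close>, and makes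
      the final estimate strict.\<close>
    define d where "d = e / (C * real (card Q) + 1)"
    have pos: "C * real (card Q) + 1 > 0"
      using C by (simp add: add_nonneg_pos)
    have "p y \<in> U" if y: "y \<in> seminorm_ball Q x d" for y
    proof -
      have "\<bar>p y - p x\<bar> \<le> p (y - x)"
        by (rule cseminorm_reverse_triangle[OF p])
      also have "\<dots> \<le> C * (\<Sum>q\<in>Q. q (y - x))"
        by (rule le)
      also have "\<dots> \<le> C * (\<Sum>q\<in>Q. d)"
        using y C by (intro mult_left_mono sum_mono) (auto simp: seminorm_ball_def less_imp_le)
      also have "\<dots> = e * (C * real (card Q) / (C * real (card Q) + 1))"
        by (simp add: d_def)
      also have "\<dots> < e * 1"
        using e(1) pos by (intro mult_strict_left_mono) auto
      finally show ?thesis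
        using e(2) by simp
    qed
    then show "\<exists>Q e. finite Q \<and> Q \<subseteq> P \<and> e > 0 \<and>
        seminorm_ball Q x e \<subseteq> {x \<in> topspace (seminorm_topology P). p x \<in> U}"
      using Q e(1) pos
      by (intro exI[of _ Q] exI[of _ d]) (auto simp: topspace_seminorm_topology d_def)
  qed
qed auto

end

subsection \<open>Seminorms that are continuous for the strict topology\<close>

definition strict_seminorms :: "('h::chilbert_space bop \<Rightarrow> real) set" where
  "strict_seminorms =
     {\<lambda>A. norm (A o\<^sub>B B) | B. compact_bop B} \<union> {\<lambda>A. norm (B o\<^sub>B A) | B. compact_bop B}"

lemma strict_topology_eq: "strict_topology = seminorm_topology strict_seminorms"
  by (simp add: strict_topology_def strict_seminorms_def)

lemma strict_seminorms_nonempty: "strict_seminorms \<noteq> {}"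
  using compact_bop_zero by (auto simp: strict_seminorms_def)

lemma strict_seminorms_cases:
  assumes "q \<in> strict_seminorms"
  obtains B where "compact_bop B" "q = (\<lambda>A. norm (A * B))"
  | B where "compact_bop B" "q = (\<lambda>A. norm (B * A))"
  using assms by (auto simp: strict_seminorms_def times_bop_def)

lemma strict_seminormsI:
  assumes "compact_bop B"
  shows "(\<lambda>A. norm (A * B)) \<in> strict_seminorms" "(\<lambda>A. norm (B * A)) \<in> strict_seminorms"
  using assms by (auto simp: strict_seminorms_def times_bop_def)

lemma cseminorm_strict: "q \<in> strict_seminorms \<Longrightarrow> cseminorm q"
  by (erule strict_seminorms_cases)
     (simp_all add: cseminorm_def norm_scaleC distrib_left distrib_right norm_triangle_ineq)

lemmas strict_seminorms_facts = cseminorm_strict strict_seminorms_nonempty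

lemma strict_seminorms_le:
  assumes "q \<in> strict_seminorms"
  shows "\<exists>C\<ge>0. \<forall>A. q A \<le> C * norm A"
  using assms
proof (cases rule: strict_seminorms_cases)
  case (1 B)
  then show ?thesis
    using norm_bop_times[of _ B] by (intro exI[of _ "norm B"]) (auto simp: mult.commute)
next
  case (2 B)
  then show ?thesis
    using norm_bop_times[of B] by (intro exI[of _ "norm B"]) auto
qed

text \<open>The neighbourhoods of \<open>0\<close> in the unit ball for the strong* topology, which on bounded sets
  coincides with the strict topology.\<close>

definition strong_star_at_0 :: "'h::chilbert_space bop filter" where
  "strong_star_at_0 =
     inf (INF v. filtercomap (\<lambda>A. norm (bop_apply A v) + norm (adj A v)) (nhds 0))
         (principal {A. norm A \<le> 1})"

lemma eventually_strong_star_norm: "eventually (\<lambda>A. norm A \<le> 1) strong_star_at_0"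
  unfolding strong_star_at_0_def by (auto simp: eventually_inf_principal)

lemma eventually_strong_star:
  assumes "0 < e"
  shows "eventually (\<lambda>A. norm (bop_apply A v) + norm (adj A v) < e) strong_star_at_0"
proof -
  have "eventually (\<lambda>x. x < e) (nhds (0::real))"
    unfolding eventually_nhds by (rule exI[of _ "{..<e}"]) (use assms in auto)
  then have "eventually (\<lambda>A. norm (bop_apply A v) + norm (adj A v) < e)
      (filtercomap (\<lambda>A. norm (bop_apply A v) + norm (adj A v)) (nhds 0))"
    unfolding eventually_filtercomap by blast
  then show ?thesis
    unfolding strong_star_at_0_def
    by (meson UNIV_I eventually_INF1 filter_leD inf_le1)
qed

lemma filterlim_strong_star:
  assumes "eventually (\<lambda>n. norm (T n) \<le> 1) G"
    and "\<And>v. ((\<lambda>n. norm (bop_apply (T n) v) + norm (adj (T n) v)) \<longlongrightarrow> 0) G"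
  shows "filterlim T strong_star_at_0 G"
  unfolding strong_star_at_0_def filterlim_inf filterlim_INF filterlim_principal
  using assms by (auto simp: filterlim_filtercomap_iff o_def)

lemma norm_bop_le_of_unit_ball:
  assumes "\<And>x. norm x \<le> 1 \<Longrightarrow> norm (bop_apply A x) \<le> b"
  shows "norm A \<le> b"
proof (rule norm_bop_bound)
  show "0 \<le> b"
    using assms[of 0] by simp
  fix x
  show "norm (bop_apply A x) \<le> b * norm x"
  proof (cases "x = 0")
    case False
    then show ?thesis
      using assms[of "(1 / norm x) *\<^sub>R x"] by (simp add: field_simps)
  qed simp
qed

text \<open>For \<open>A * B\<close>, a finite net for the image of the unit ball under
  \<open>B\<close> reduces the norm to finitely many vectors. For \<open>B * A\<close>, compactness
  of the adjoint of \<open>B\<close> is avoided: with \<open>y = B A x\<close>, one factor in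
  \<open>cinner y y\<close> is replaced by a net point \<open>w\<close> of \<open>B\<close>, and
  \<open>cinner y w\<close> equals \<open>cinner x (adj A (adj B w))\<close>, which is small by the
  adjoint half of the strong* topology.\<close>

lemma strict_seminorm_tendsto_0:
  assumes "q \<in> strict_seminorms"
  shows "(q \<longlongrightarrow> 0) strong_star_at_0"
proof (rule tendstoI)
  fix e :: real
  assume e: "e > 0"
  have "eventually (\<lambda>A. q A \<le> e / 2) strong_star_at_0"
    using assms
  proof (cases rule: strict_seminorms_cases)
    case (1 B)
    obtain W where W: "finite W" "\<And>x. norm x \<le> 1 \<Longrightarrow> \<exists>w\<in>W. norm (bop_apply B x - w) < e / 4"
      using 1(1) e unfolding compact_bop_iff_net by (meson divide_pos_pos zero_less_numeral)
    have "eventually (\<lambda>A. \<forall>w\<in>W. norm (bop_apply A w) + norm (adj A w) < e / 4) strong_star_at_0"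
      using W(1) e by (intro eventually_ball_finite ballI eventually_strong_star) auto
    then show ?thesis
      using eventually_strong_star_norm
    proof eventually_elim
      case (elim A)
      show ?case
        unfolding 1(2)
      proof (rule norm_bop_le_of_unit_ball)
        fix x :: 'a
        assume "norm x \<le> 1"
        then obtain w where w: "w \<in> W" "norm (bop_apply B x - w) < e / 4"
          using W(2) by blast
        have "norm (bop_apply A (bop_apply B x - w)) \<le> norm A * norm (bop_apply B x - w)"
          by (rule norm_bop_apply)
        also have "\<dots> \<le> 1 * (e / 4)"
          using elim(2) w(2) by (intro mult_mono) auto
        finally have "norm (bop_apply A (bop_apply B x) - bop_apply A w) \<le> e / 4"
          by simp
        moreover have "norm (bop_apply A w) \<le> e / 4"
          using bspec[OF elim(1) w(1)] norm_ge_zero[of "adj A w"] by linarith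
        ultimately show "norm (bop_apply (A * B) x) \<le> e / 2"
          using norm_triangle_sub[of "bop_apply A (bop_apply B x)" "bop_apply A w"] by simp
      qed
    qed
  next
    case (2 B)
    \<comment> \<open>Both parts of \<open>cinner y y\<close> will be at most \<open>d\<close>,
      hence \<open>norm y \<le> e / 2\<close>. The mesh \<open>h\<close> of the net is divided by
      \<open>norm B + 1\<close> because the replaced factor is paired with \<open>y\<close>, of norm
      at most \<open>norm B\<close>.\<close>
    define d where "d = (e / 2)\<^sup>2 / 2"
    define h where "h = d / (norm B + 1)"
    have dh: "d > 0" "h > 0" "norm B * h \<le> d"
    proof -
      show "d > 0"
        using e by (simp add: d_def)
      then show "h > 0"
        by (simp add: h_def add_nonneg_pos)
      have "norm B * h \<le> (norm B + 1) * h"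
        using \<open>h > 0\<close> by (intro mult_right_mono) auto
      also have "\<dots> = d"
        using norm_ge_zero[of B] by (simp add: h_def add_nonneg_eq_0_iff)
      finally show "norm B * h \<le> d" .
    qed
    obtain W where W: "finite W" "\<And>x. norm x \<le> 1 \<Longrightarrow> \<exists>w\<in>W. norm (bop_apply B x - w) < h"
      using 2(1) dh(2) unfolding compact_bop_iff_net by meson
    have "eventually (\<lambda>A. \<forall>w\<in>W. norm (bop_apply A (adj B w)) + norm (adj A (adj B w)) < d)
        strong_star_at_0"
      using W(1) dh(1) by (intro eventually_ball_finite ballI eventually_strong_star) auto
    then show ?thesis
      using eventually_strong_star_norm
    proof eventually_elim
      case (elim A)
      show ?case
        unfolding 2(2)
      proof (rule norm_bop_le_of_unit_ball)
        fix x :: 'a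
        assume x: "norm x \<le> 1"
        define y where "y = bop_apply B (bop_apply A x)"
        have Ax: "norm (bop_apply A x) \<le> 1"
          using norm_bop_apply[of A x] mult_mono[of "norm A" 1 "norm x" 1] x elim(2) by simp
        then obtain w where w: "w \<in> W" "norm (y - w) < h"
          using W(2) unfolding y_def by blast
        have "norm y \<le> norm B"
          using norm_bop_apply[of B "bop_apply A x"] mult_left_mono[OF Ax, of "norm B"]
          by (simp add: y_def)
        have "cmod (cinner y (y - w)) \<le> norm y * norm (y - w)"
          by (rule cmod_cinner_le)
        also have "\<dots> \<le> norm B * h"
          using \<open>norm y \<le> norm B\<close> w(2) by (intro mult_mono) auto
        finally have 1: "cmod (cinner y (y - w)) \<le> d"
          using dh(3) by linarith
        have small: "norm (adj A (adj B w)) \<le> d"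
          using bspec[OF elim(1) w(1)] norm_ge_zero[of "bop_apply A (adj B w)"] by linarith
        have "cinner y w = cinner x (adj A (adj B w))"
          by (simp add: y_def cinner_adj)
        also have "cmod \<dots> \<le> norm x * norm (adj A (adj B w))"
          by (rule cmod_cinner_le)
        also have "\<dots> \<le> 1 * d"
          using x small by (intro mult_mono) auto
        finally have 2: "cmod (cinner y w) \<le> d"
          by simp
        have "(norm y)\<^sup>2 = Re (cinner y (y - w) + cinner y w)"
          by (simp add: power2_norm_eq_cinner cinner_diff_right)
        also have "\<dots> \<le> d + d"
          using 1 2 complex_Re_le_cmod[of "cinner y (y - w)"] complex_Re_le_cmod[of "cinner y w"]
          by simp
        also have "\<dots> = (e / 2)\<^sup>2"
          by (simp add: d_def)
        finally have "norm y \<le> e / 2"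
          by (rule power2_le_imp_le) (use e in simp)
        then show "norm (bop_apply (B * A) x) \<le> e / 2"
          by (simp add: y_def)
      qed
    qed
  qed
  then show "eventually (\<lambda>A. dist (q A) 0 < e) strong_star_at_0"
  proof eventually_elim
    case (elim A)
    then show ?case
      using e cseminorm_nonneg[OF cseminorm_strict[OF assms], of A] by simp
  qed
qed

section \<open>The criterion of smallness off finite sets\<close>

lemma strict_continuous_imp:
  assumes p: "cseminorm p" and cont: "continuous_map strict_topology euclidean p"
  shows "(p \<longlongrightarrow> 0) strong_star_at_0" and "\<exists>C\<ge>0. \<forall>A. p A \<le> C * norm A"
proof -
  obtain Q C where Q: "finite Q" "Q \<subseteq> strict_seminorms" "0 \<le> C" "\<And>x. p x \<le> C * (\<Sum>q\<in>Q. q x)"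
    using continuous_seminorm_bound[OF strict_seminorms_facts p cont[unfolded strict_topology_eq]]
    by blast
  have "((\<lambda>A. C * (\<Sum>q\<in>Q. q A)) \<longlongrightarrow> C * (\<Sum>q\<in>Q. 0)) strong_star_at_0"
    using Q(2) by (intro tendsto_intros strict_seminorm_tendsto_0) auto
  then show "(p \<longlongrightarrow> 0) strong_star_at_0"
    by (intro tendsto_sandwich[where f="\<lambda>_. 0" and g=p and h="\<lambda>A. C * (\<Sum>q\<in>Q. q A)"])
       (auto intro!: always_eventually simp: cseminorm_nonneg[OF p] Q(4))
  obtain c where c: "\<And>q. q \<in> Q \<Longrightarrow> 0 \<le> c q \<and> (\<forall>A. q A \<le> c q * norm A)"
    using strict_seminorms_le Q(2) by (metis subsetD)
  have "p A \<le> (C * (\<Sum>q\<in>Q. c q)) * norm A" for A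
  proof -
    have "(\<Sum>q\<in>Q. q A) \<le> (\<Sum>q\<in>Q. c q) * norm A"
      unfolding sum_distrib_right using c by (intro sum_mono) auto
    then show ?thesis
      using order_trans[OF Q(4) mult_left_mono[OF _ Q(3)]] by (simp add: mult.assoc)
  qed
  then show "\<exists>C\<ge>0. \<forall>A. p A \<le> C * norm A"
    using Q(3) c by (intro exI[of _ "C * (\<Sum>q\<in>Q. c q)"]) (auto intro!: mult_nonneg_nonneg sum_nonneg)
qed

text \<open>Unlike a strong* neighbourhood of 0, this condition is invariant under scaling, so it
  can be combined with a homogeneous bound \<open>e * norm A\<close>.\<close>

definition vanishes_on :: "'h::chilbert_space bop \<Rightarrow> 'h set \<Rightarrow> bool" where
  "vanishes_on A V \<longleftrightarrow> (\<forall>v\<in>V. bop_apply A v = 0 \<and> adj A v = 0)"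

text \<open>A strong* neighbourhood tests finitely many vectors. An operator vanishing there,
  together with its adjoint, has all test values equal to 0 and so lies in the neighbourhood however
  small it is; scaling to norm 1 does the rest.\<close>

lemma strong_star_small_off_finite:
  assumes p: "cseminorm p" and lim: "(p \<longlongrightarrow> 0) strong_star_at_0" and e: "e > 0"
  shows "\<exists>V. finite V \<and> (\<forall>A. vanishes_on A V \<longrightarrow> p A \<le> e * norm A)"
proof -
  have "eventually (\<lambda>A. p A < e) strong_star_at_0"
    using order_tendstoD(2)[OF lim e] .
  then obtain V where V: "finite V"
    "eventually (\<lambda>A. norm A \<le> 1 \<longrightarrow> p A < e)
      (INF v\<in>V. filtercomap (\<lambda>A. norm (bop_apply A v) + norm (adj A v)) (nhds 0))"
    unfolding strong_star_at_0_def eventually_inf_principal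
    by (subst (asm) eventually_INF) auto
  then obtain Q where Q:
    "\<And>v. v \<in> V \<Longrightarrow> eventually (Q v) (filtercomap (\<lambda>A. norm (bop_apply A v) + norm (adj A v)) (nhds 0))"
    "\<And>A. \<forall>v\<in>V. Q v A \<Longrightarrow> norm A \<le> 1 \<longrightarrow> p A < e"
    unfolding eventually_INF_finite[OF V(1)] by blast
  have small: "p A < e" if A: "vanishes_on A V" "norm A \<le> 1" for A
  proof -
    have "Q v A" if "v \<in> V" for v
    proof -
      obtain R where R: "eventually R (nhds (0::real))"
        "\<And>A. R (norm (bop_apply A v) + norm (adj A v)) \<Longrightarrow> Q v A"
        using Q(1)[OF \<open>v \<in> V\<close>] unfolding eventually_filtercomap by blast
      have "R 0"
        by (rule eventually_nhds_x_imp_x[OF R(1)])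
      then show ?thesis
        using R(2)[of A] A(1) \<open>v \<in> V\<close> by (simp add: vanishes_on_def)
    qed
    then show ?thesis
      using Q(2) A(2) by blast
  qed
  have "p A \<le> e * norm A" if A: "vanishes_on A V" for A
  proof (cases "A = 0")
    case False
    have "vanishes_on ((1 / norm A) *\<^sub>R A) V"
      using A by (simp add: vanishes_on_def adj_scaleR)
    then have "p ((1 / norm A) *\<^sub>R A) < e"
      using False by (intro small) auto
    then show ?thesis
      using False by (simp add: cseminorm_scaleR[OF p] field_simps)
  qed (simp add: cseminorm_zero[OF p])
  then show ?thesis
    using V(1) by blast
qed

text \<open>With \<open>P n\<close> increasing finite rank projections such that \<open>p A \<le> 4\<^sup>-\<^sup>n * norm A\<close> whenever
  \<open>P n * A = A * P n = 0\<close>, telescope \<open>A\<close> along \<open>(1 - P n) * A * (1 - P n)\<close>: the \<open>n\<close>th difference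
  is controlled by \<open>E n * A\<close> and \<open>A * E n\<close> with \<open>E n = P (Suc n) - P n\<close>, so the compact operator
  \<open>\<Sum>n. 2\<^sup>-\<^sup>n E n\<close> dominates \<open>p\<close>.\<close>

lemma strict_domination:
  fixes K :: "('h::chilbert_space bop \<Rightarrow> real) set"
  assumes K: "\<And>p. p \<in> K \<Longrightarrow> cseminorm p"
    and bdd: "\<And>p A. p \<in> K \<Longrightarrow> p A \<le> C * norm A" and C: "0 \<le> C"
    and small: "\<And>e. e > 0 \<Longrightarrow>
      \<exists>V. finite V \<and> (\<forall>p\<in>K. \<forall>A. vanishes_on A V \<longrightarrow> p A \<le> e * norm A)"
  shows "\<exists>B c. compact_bop B \<and> 0 \<le> c \<and> (\<forall>p\<in>K. \<forall>A. p A \<le> c * (norm (A * B) + norm (B * A)))"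
proof -
  \<comment> \<open>The rate 1/4 is matched to the weights \<open>(1/2)^n\<close> of the blocks in
    \<open>B\<close>: recovering a block from \<open>B\<close> costs \<open>2^n\<close>, and
    \<open>(1/2)^n\<close> is left for summation.\<close>
  have "\<exists>V. finite V \<and> (\<forall>p\<in>K. \<forall>A. vanishes_on A V \<longrightarrow> p A \<le> (1/4)^n * norm A)" for n
    using small[of "(1/4)^n"] by simp
  then obtain V where V: "\<And>n. finite (V n)"
    "\<And>n p A. p \<in> K \<Longrightarrow> vanishes_on A (V n) \<Longrightarrow> p A \<le> (1/4)^n * norm A"
    by metis
  \<comment> \<open>The vectors of \<open>V n\<close> are absorbed only at index
    \<open>Suc n\<close>. Thus \<open>F 0\<close> can be empty, and the telescoping starts at
    \<open>A\<close> itself.\<close>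
  have "\<exists>F. F 0 = {} \<and> (\<forall>n. orthonormal (F n) \<and> F n \<subseteq> F (Suc n) \<and>
      (\<forall>v\<in>V n. bop_apply (proj (F (Suc n))) v = v))"
  proof -
    define g where "g n F = (SOME G. orthonormal G \<and> F \<subseteq> G \<and> (\<forall>v\<in>V n. bop_apply (proj G) v = v))"
      for n F
    have g: "orthonormal (g n F) \<and> F \<subseteq> g n F \<and> (\<forall>v\<in>V n. bop_apply (proj (g n F)) v = v)"
      if "orthonormal F" for n F
      unfolding g_def by (rule someI_ex[OF orthonormal_extend[OF V(1) that]])
    define F where "F = rec_nat {} g"
    have F: "F 0 = {}" "\<And>n. F (Suc n) = g n (F n)"
      by (simp_all add: F_def)
    have "orthonormal (F n)" for n
    proof (induction n)
      case 0
      then show ?case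
        by (simp add: F orthonormal_def)
    next
      case (Suc n)
      then show ?case
        using g by (simp add: F(2))
    qed
    then show ?thesis
      using g by (intro exI[of _ F]) (simp add: F)
  qed
  then obtain F where F: "F 0 = {}" "\<And>n. orthonormal (F n)" "\<And>n. F n \<subseteq> F (Suc n)"
    "\<And>n v. v \<in> V n \<Longrightarrow> bop_apply (proj (F (Suc n))) v = v"
    by blast
  have F_mono: "F m \<subseteq> F n" if "m \<le> n" for m n
    using F(3) that by (rule lift_Suc_mono_le)
  define P where "P n = proj (F n)" for n
  have PP: "P m * P n = P (min m n)" for m n
  proof (cases "m \<le> n")
    case True
    then show ?thesis
      using proj_times[OF F(2) F_mono[OF True] order_refl] F_mono[OF True]
      by (simp add: P_def Int_absorb2)
  next
    case False
    then have "n \<le> m"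
      by simp
    then show ?thesis
      using proj_times[OF F(2) order_refl F_mono[of n m]] F_mono[of n m]
      by (simp add: P_def Int_absorb1 min_absorb2)
  qed
  have nP: "norm (1 - P n) \<le> 2" for n
    using norm_triangle_ineq4[of 1 "P n"] norm_bop_one_le[where 'a='h] norm_proj_le[OF F(2)[of n]]
    by (simp add: P_def)
  \<comment> \<open>The 4 pays for the index shift, \<open>(1/4)^m = 4 * (1/4)^(Suc m)\<close>;
    \<open>C\<close> covers index 0, where \<open>P 0 = 0\<close> imposes nothing on
    \<open>A\<close>.\<close>
  define D where "D = C + 4"
  have D: "D \<ge> 0" "C \<le> D" "4 \<le> D"
    using C by (auto simp: D_def)
  have small': "p A \<le> D * (1/4)^n * norm A" if p: "p \<in> K" and A: "P n * A = 0" "A * P n = 0" for p A n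
  proof (cases n)
    case 0
    then show ?thesis
      using bdd[OF p, of A] mult_right_mono[OF D(2), of "norm A"] by simp
  next
    case (Suc m)
    have "vanishes_on A (V m)"
      unfolding vanishes_on_def
    proof
      fix v
      assume "v \<in> V m"
      then have v: "bop_apply (P n) v = v"
        using F(4) by (simp add: P_def Suc)
      have "bop_apply (A * P n) v = 0"
        by (simp add: A)
      moreover have "adj (P n * A) v = adj A v"
        using v by (simp add: adj_times P_def)
      moreover have "adj (P n * A) v = 0"
        by (rule adj_eqI) (simp add: A)
      ultimately show "bop_apply A v = 0 \<and> adj A v = 0"
        using v by simp
    qed
    then have "p A \<le> (1/4)^m * norm A"
      by (rule V(2)[OF p])
    also have "(1/4::real)^m = 4 * (1/4)^n"
      by (simp add: Suc)
    also have "4 * (1/4)^n * norm A \<le> D * (1/4)^n * norm A"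
      using D(3) by (intro mult_right_mono) auto
    finally show ?thesis .
  qed
  define E where "E n = P (Suc n) - P n" for n
  have E_proj: "E n = proj (F (Suc n) - F n)" for n
    using F(2)[of "Suc n"] F(3)[of n] by (simp add: E_def P_def proj_Diff orthonormal_def)
  have nE: "norm (E n) \<le> 1" for n
    unfolding E_proj by (rule norm_proj_le[OF orthonormal_subset[OF F(2)]]) auto
  have EE: "E m * E n = (if m = n then E n else 0)" for m n
    by (cases m n rule: linorder_cases)
       (simp_all add: E_def left_diff_distrib right_diff_distrib PP min_absorb1 min_absorb2)
  have summ: "summable (\<lambda>n. (1/2)^n *\<^sub>R E n)"
  proof (rule summable_comparison_test')
    show "summable (\<lambda>n. (1/2::real)^n)"
      by (rule summable_geometric) simp
    show "norm ((1/2)^n *\<^sub>R E n) \<le> (1/2)^n" for n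
      using nE[of n] by (simp add: mult_left_le)
  qed
  define B where "B = (\<Sum>n. (1/2)^n *\<^sub>R E n)"
  have B_sums: "(\<lambda>n. (1/2)^n *\<^sub>R E n) sums B"
    unfolding B_def by (rule summable_sums[OF summ])
  have compB: "compact_bop B"
    using B_sums unfolding sums_def
    by (rule compact_bop_LIMSEQ[rotated])
       (auto intro!: compact_bop_sum compact_bop_scaleR_proj simp: E_proj)
  have EB: "E m * B = (1/2)^m *\<^sub>R E m" "B * E m = (1/2)^m *\<^sub>R E m" for m
  proof -
    have s: "(\<lambda>n. if n = m then (1/2)^n *\<^sub>R E n else 0) sums ((1/2)^m *\<^sub>R E m)"
      using sums_If_finite_set[of "{m}" "\<lambda>n. (1/2)^n *\<^sub>R E n"] by simp
    have "(\<lambda>n. E m * ((1/2)^n *\<^sub>R E n)) sums (E m * B)"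
      by (rule bounded_linear.sums[OF bounded_linear_mult_right B_sums])
    moreover have "(\<lambda>n. E m * ((1/2)^n *\<^sub>R E n)) = (\<lambda>n. if n = m then (1/2)^n *\<^sub>R E n else 0)"
      by (auto simp: EE fun_eq_iff)
    ultimately show "E m * B = (1/2)^m *\<^sub>R E m"
      using s by (simp add: sums_unique2)
    have "(\<lambda>n. ((1/2)^n *\<^sub>R E n) * E m) sums (B * E m)"
      by (rule bounded_linear.sums[OF bounded_linear_mult_left B_sums])
    moreover have "(\<lambda>n. ((1/2)^n *\<^sub>R E n) * E m) = (\<lambda>n. if n = m then (1/2)^n *\<^sub>R E n else 0)"
      by (auto simp: EE fun_eq_iff)
    ultimately show "B * E m = (1/2)^m *\<^sub>R E m"
      using s by (simp add: sums_unique2)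
  qed
  \<comment> \<open>On the block \<open>E m\<close> the operator \<open>B\<close> acts as the scalar
    \<open>(1/2)^m\<close>, so it can be undone there at the price of \<open>2^m\<close>.\<close>
  have nEA: "norm (E m * A) \<le> 2^m * norm (B * A)" "norm (A * E m) \<le> 2^m * norm (A * B)" for m A
  proof -
    have "norm ((1/2)^m *\<^sub>R (E m * A)) = norm (E m * (B * A))"
      by (simp add: mult.assoc[symmetric] EB)
    also have "\<dots> \<le> 1 * norm (B * A)"
      using norm_bop_times[of "E m" "B * A"] mult_right_mono[OF nE[of m], of "norm (B * A)"] by simp
    finally show "norm (E m * A) \<le> 2^m * norm (B * A)"
      by (simp add: field_simps)
    have "norm ((1/2)^m *\<^sub>R (A * E m)) = norm ((A * B) * E m)"
      by (simp add: mult.assoc EB)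
    also have "\<dots> \<le> norm (A * B) * 1"
      using norm_bop_times[of "A * B" "E m"] mult_left_mono[OF nE[of m], of "norm (A * B)"] by simp
    finally show "norm (A * E m) \<le> 2^m * norm (A * B)"
      by (simp add: field_simps)
  qed
  have main: "p A \<le> 4 * D * (norm (A * B) + norm (B * A))" if p: "p \<in> K" for p A
  proof -
    note pn = K[OF p]
    define s where "s = norm (A * B) + norm (B * A)"
    define R where "R n = (1 - P n) * A * (1 - P n)" for n
    have PR: "P n * R m = 0" "R m * P n = 0" if "n \<le> m" for m n
    proof -
      have 0: "P n * (1 - P m) = 0" "(1 - P m) * P n = 0"
        using that by (simp_all add: left_diff_distrib right_diff_distrib PP min_absorb1 min_absorb2)
      have "P n * R m = (P n * (1 - P m)) * (A * (1 - P m))"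
        by (simp only: R_def mult.assoc)
      then show "P n * R m = 0"
        by (simp only: 0 mult_zero_left)
      have "R m * P n = (1 - P m) * A * ((1 - P m) * P n)"
        by (simp only: R_def mult.assoc)
      then show "R m * P n = 0"
        by (simp only: 0 mult_zero_right)
    qed
    have R0: "R 0 = A"
      by (simp add: R_def P_def F(1))
    have step: "p (R n - R (Suc n)) \<le> 4 * D * s * (1/2)^(Suc n)" for n
    proof -
      \<comment> \<open>The projections are exchanged one side at a time, so that in each term
        \<open>E n\<close> stands next to \<open>A\<close> and \<open>nEA\<close> applies.\<close>
      have eq: "R n - R (Suc n) = E n * A * (1 - P n) + (1 - P (Suc n)) * A * E n"
        by (simp add: R_def E_def algebra_simps)
      have "norm (R n - R (Suc n)) \<le> norm (E n * A * (1 - P n)) + norm ((1 - P (Suc n)) * (A * E n))"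
        unfolding eq by (simp add: mult.assoc norm_triangle_ineq)
      also have "\<dots> \<le> norm (E n * A) * 2 + 2 * norm (A * E n)"
        by (intro add_mono order_trans[OF norm_bop_times mult_left_mono[OF nP]]
            order_trans[OF norm_bop_times mult_right_mono[OF nP]]) auto
      also have "\<dots> \<le> 2 * 2^n * s"
        using nEA[where m=n and A=A] by (simp add: s_def algebra_simps)
      finally have n: "norm (R n - R (Suc n)) \<le> 2 * 2^n * s" .
      \<comment> \<open>Both \<open>R n\<close> and \<open>R (Suc n)\<close> are annihilated by
        \<open>P n\<close> from either side, so the bound for index \<open>n\<close> holds for their
        difference.\<close>
      have "p (R n - R (Suc n)) \<le> D * (1/4)^n * norm (R n - R (Suc n))"
        by (rule small'[OF p]) (simp_all add: PR left_diff_distrib right_diff_distrib)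
      also have "\<dots> \<le> D * (1/4)^n * (2 * 2^n * s)"
        using n D(1) by (intro mult_left_mono) auto
      also have "\<dots> = 4 * D * s * (1/2)^(Suc n)"
        by (simp add: field_simps flip: power_mult_distrib)
      finally show ?thesis .
    qed
    have partial: "p A \<le> 4 * D * s * (1 - (1/2)^n) + p (R n)" for n
    proof (induction n)
      case 0
      then show ?case
        by (simp add: R0)
    next
      case (Suc n)
      have "p (R n) \<le> p (R n - R (Suc n)) + p (R (Suc n))"
        using cseminorm_triangle[OF pn, of "R n - R (Suc n)" "R (Suc n)"] by simp
      with Suc step[of n] show ?case
        by (simp add: algebra_simps)
    qed
    have "p A \<le> 4 * D * s * (1 - (1/2)^n) + D * (1/4)^n * (4 * norm A)" for n
    proof -
      have "norm (R n) \<le> norm ((1 - P n) * A) * norm (1 - P n)"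
        unfolding R_def by (rule norm_bop_times)
      also have "\<dots> \<le> (2 * norm A) * 2"
        by (intro mult_mono order_trans[OF norm_bop_times mult_right_mono[OF nP]] nP) auto
      finally have "norm (R n) \<le> 4 * norm A"
        by simp
      then have "D * (1/4)^n * norm (R n) \<le> D * (1/4)^n * (4 * norm A)"
        using D(1) by (intro mult_left_mono) auto
      moreover have "p (R n) \<le> D * (1/4)^n * norm (R n)"
        by (rule small'[OF p]) (simp_all add: PR)
      ultimately show ?thesis
        using partial[of n] by linarith
    qed
    moreover have "(\<lambda>n. 4 * D * s * (1 - (1/2)^n) + D * (1/4)^n * (4 * norm A))
        \<longlonglongrightarrow> 4 * D * s * (1 - 0) + D * 0 * (4 * norm A)"
      by (intro tendsto_intros LIMSEQ_power_zero) auto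
    ultimately have "p A \<le> 4 * D * s * (1 - 0) + D * 0 * (4 * norm A)"
      by (intro LIMSEQ_le_const) auto
    then show ?thesis
      by (simp add: s_def)
  qed
  show ?thesis
    using compB main D(1) by (intro exI[of _ B] exI[of _ "4 * D"]) auto
qed

subsection \<open>Pointwise compact families of countably additive set functions\<close>

text \<open>The topology of pointwise convergence need not be metrizable, so compactness yields a
  cluster point and not a convergent subsequence. Closeness at finitely many points, at arbitrarily
  late indices, is the form in which it is used.\<close>

lemma compact_fun_cluster_point:
  fixes u :: "nat \<Rightarrow> 'a \<Rightarrow> complex"
  assumes "compact K" "\<And>n. u n \<in> K"
  shows "\<exists>g\<in>K. \<forall>F d N. finite F \<longrightarrow> 0 < d \<longrightarrow> (\<exists>n\<ge>N. \<forall>a\<in>F. cmod (u n a - g a) < d)"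
proof -
  have "filtermap u sequentially \<noteq> bot"
    by (simp add: filtermap_bot_iff)
  moreover have "eventually (\<lambda>h. h \<in> K) (filtermap u sequentially)"
    using assms(2) by (simp add: eventually_filtermap)
  ultimately obtain g where g: "g \<in> K" "inf (nhds g) (filtermap u sequentially) \<noteq> bot"
    using assms(1) unfolding compact_filter by blast
  have "\<exists>n\<ge>N. \<forall>a\<in>F. cmod (u n a - g a) < d" if F: "finite F" and d: "d > 0" for F d N
  proof (rule ccontr)
    assume no: "\<not> ?thesis"
    define U where "U = {h. \<forall>a\<in>F. h a \<in> ball (g a) d}"
    have "open U"
      unfolding U_def using product_topology_basis'[OF F, of "\<lambda>a. ball (g a) d" "\<lambda>a. a"] by simp
    moreover have "g \<in> U"
      using d by (simp add: U_def)
    ultimately have "eventually (\<lambda>h. h \<in> U) (nhds g)"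
      by (rule eventually_nhds_in_open)
    moreover have "u n \<notin> U" if "n \<ge> N" for n
    proof
      assume "u n \<in> U"
      then have "\<forall>a\<in>F. cmod (u n a - g a) < d"
        by (simp add: U_def dist_norm norm_minus_commute)
      then show False
        using no that by blast
    qed
    then have "eventually (\<lambda>h. h \<notin> U) (filtermap u sequentially)"
      by (auto simp: eventually_filtermap eventually_sequentially)
    ultimately have "eventually (\<lambda>_. False) (inf (nhds g) (filtermap u sequentially))"
      unfolding eventually_inf by blast
    then show False
      using g(2) by (simp add: trivial_limit_def)
  qed
  then show ?thesis
    using g(1) by blast
qed

text \<open>A gliding hump: after subtracting a cluster point \<open>g\<close>, a bad sequence of set functions is
  concentrated on the points of a set \<open>S\<close>, so any cluster point along \<open>S\<close> differs from \<open>g\<close> at \<open>S\<close>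
  while agreeing with it on all finite sets.\<close>

lemma compact_additive_uniformly_small:
  fixes K :: "('a \<Rightarrow> complex) set" and A :: "nat set \<Rightarrow> 'a"
  assumes K: "compact K"
    and add: "\<And>f S T. f \<in> K \<Longrightarrow> S \<inter> T = {} \<Longrightarrow> f (A (S \<union> T)) = f (A S) + f (A T)"
    and tail: "\<And>f d. f \<in> K \<Longrightarrow> d > 0 \<Longrightarrow> \<exists>N. \<forall>S. S \<subseteq> {N..} \<longrightarrow> cmod (f (A S)) < d"
    and e: "e > 0"
  shows "\<exists>n. \<forall>f\<in>K. cmod (f (A {n})) \<le> e"
proof (rule ccontr)
  assume "\<not> ?thesis"
  then have "\<forall>n. \<exists>f. f \<in> K \<and> e < cmod (f (A {n}))"
    by (auto simp: not_le)
  then obtain f where f: "\<And>n. f n \<in> K" "\<And>n. e < cmod (f n (A {n}))"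
    by metis
  obtain g where g: "g \<in> K"
    "\<And>F d N. finite F \<Longrightarrow> d > 0 \<Longrightarrow> \<exists>n\<ge>N. \<forall>a\<in>F. cmod (f n a - g a) < d"
    using compact_fun_cluster_point[of K f, OF K f(1)] by blast
  define \<nu> where "\<nu> n S = f n (A S) - g (A S)" for n S
  have \<nu>_add: "\<nu> n (S \<union> T) = \<nu> n S + \<nu> n T" if "S \<inter> T = {}" for n S T
    using add[OF f(1) that] add[OF g(1) that] by (simp add: \<nu>_def)
  obtain N0 where N0: "\<And>S. S \<subseteq> {N0..} \<Longrightarrow> cmod (g (A S)) < e / 2"
    using tail[OF g(1), of "e / 2"] e by auto
  \<comment> \<open>Subtracting \<open>g\<close> costs at most \<open>e / 2\<close> on the diagonal,
    since a singleton far out is a tail set for \<open>g\<close>.\<close>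
  have \<nu>_diag: "e / 2 < cmod (\<nu> n {n})" if "n \<ge> N0" for n
    using f(2)[of n] N0[of "{n}"] that norm_triangle_ineq2[of "f n (A {n})" "g (A {n})"]
    by (simp add: \<nu>_def)
  have "\<exists>M. \<forall>S. S \<subseteq> {M..} \<longrightarrow> cmod (\<nu> n S) < e / 8" for n
  proof -
    obtain N1 where N1: "\<And>S. S \<subseteq> {N1..} \<Longrightarrow> cmod (f n (A S)) < e / 16"
      using tail[OF f(1), of "e / 16" n] e by auto
    obtain N2 where N2: "\<And>S. S \<subseteq> {N2..} \<Longrightarrow> cmod (g (A S)) < e / 16"
      using tail[OF g(1), of "e / 16"] e by auto
    have "cmod (\<nu> n S) < e / 8" if "S \<subseteq> {max N1 N2..}" for S
    proof -
      have "S \<subseteq> {N1..}" "S \<subseteq> {N2..}"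
        using that by auto
      then have "cmod (f n (A S)) < e / 16" "cmod (g (A S)) < e / 16"
        using N1 N2 by blast+
      then show ?thesis
        using norm_triangle_ineq4[of "f n (A S)" "g (A S)"] unfolding \<nu>_def by linarith
    qed
    then show ?thesis
      by blast
  qed
  then obtain M where M: "\<And>n S. S \<subseteq> {M n..} \<Longrightarrow> cmod (\<nu> n S) < e / 8"
    by metis
  \<comment> \<open>All subsets of \<open>{..n}\<close> can be tested at once because there are
    finitely many. The bound is at most \<open>e / 8\<close>, as the hump needs, and tends to 0 with
    \<open>n\<close>, which later forces agreement with \<open>g\<close> on finite sets.\<close>
  have "\<exists>m. n < m \<and> N0 \<le> m \<and> M n \<le> m \<and> (\<forall>S. S \<subseteq> {..n} \<longrightarrow> cmod (\<nu> m S) < e / (8 * (real n + 1)))"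
    for n
  proof -
    have "\<exists>m\<ge>max (Suc n) (max N0 (M n)).
        \<forall>a \<in> A ` Pow {..n}. cmod (f m a - g a) < e / (8 * (real n + 1))"
      by (rule g(2)) (use e in auto)
    then obtain m where m: "m \<ge> max (Suc n) (max N0 (M n))"
      "\<forall>a \<in> A ` Pow {..n}. cmod (f m a - g a) < e / (8 * (real n + 1))"
      by blast
    then show ?thesis
      by (intro exI[of _ m]) (auto simp: \<nu>_def)
  qed
  then obtain nx where nx: "\<And>n. n < nx n" "\<And>n. N0 \<le> nx n" "\<And>n. M n \<le> nx n"
    "\<And>n S. S \<subseteq> {..n} \<Longrightarrow> cmod (\<nu> (nx n) S) < e / (8 * (real n + 1))"
    by metis
  define s where "s k = (nx ^^ k) N0" for k
  have s_Suc: "s (Suc k) = nx (s k)" for k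
    by (simp add: s_def)
  have mono: "strict_mono s"
    by (rule strict_monoI_Suc) (simp add: s_Suc nx(1))
  have s_ge: "k \<le> s k" for k
    using strict_mono_imp_increasing[OF mono] .
  define S where "S = range s"
  \<comment> \<open>For the index \<open>?n\<close>, the earlier points of \<open>S\<close> are
    negligible by the choice of \<open>?n\<close>, and the later ones because the next index lies
    beyond \<open>M ?n\<close>. What remains exceeds \<open>e / 2 - e / 8 - e / 8\<close>.\<close>
  have big: "e / 4 < cmod (\<nu> (s (Suc k)) S)" for k
  proof -
    let ?n = "s (Suc k)"
    define S1 where "S1 = S \<inter> {..s k}"
    define S2 where "S2 = S \<inter> {s (Suc (Suc k))..}"
    have S: "S = (S1 \<union> {?n}) \<union> S2"
    proof -
      have "x \<in> S1 \<union> {?n} \<union> S2" if "x \<in> S" for x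
      proof -
        obtain j where j: "x = s j"
          using \<open>x \<in> S\<close> by (auto simp: S_def)
        consider "j \<le> k" | "j = Suc k" | "Suc (Suc k) \<le> j"
          by linarith
        then show ?thesis
          using \<open>x \<in> S\<close> strict_mono_less_eq[OF mono] by cases (auto simp: j S1_def S2_def)
      qed
      then show ?thesis
        by (auto simp: S1_def S2_def S_def)
    qed
    have lt: "s k < ?n" "?n < s (Suc (Suc k))"
      using mono by (simp_all add: strict_mono_less)
    have eq: "\<nu> ?n S = \<nu> ?n S1 + \<nu> ?n {?n} + \<nu> ?n S2"
    proof -
      have "S1 \<inter> {?n} = {}" "(S1 \<union> {?n}) \<inter> S2 = {}"
        using lt by (auto simp: S1_def S2_def)
      then show ?thesis
        by (subst S) (simp only: \<nu>_add)
    qed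
    have "cmod (\<nu> ?n S1) < e / 8"
    proof -
      have "cmod (\<nu> ?n S1) < e / (8 * (real (s k) + 1))"
        using nx(4)[of S1 "s k"] by (simp add: S1_def s_Suc)
      also have "\<dots> \<le> e / 8"
        using e by (intro divide_left_mono) auto
      finally show ?thesis .
    qed
    moreover have "cmod (\<nu> ?n S2) < e / 8"
    proof (rule M)
      show "S2 \<subseteq> {M ?n..}"
        using nx(3)[of ?n] by (auto simp: S2_def s_Suc[of "Suc k"])
    qed
    moreover have "e / 2 < cmod (\<nu> ?n {?n})"
      by (rule \<nu>_diag) (simp add: s_Suc nx(2))
    moreover have "cmod (\<nu> ?n {?n}) \<le> cmod (\<nu> ?n S1 + \<nu> ?n {?n} + \<nu> ?n S2) + cmod (\<nu> ?n S1) + cmod (\<nu> ?n S2)"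
      using norm_triangle_ineq4[of "\<nu> ?n S1 + \<nu> ?n {?n} + \<nu> ?n S2" "\<nu> ?n S1 + \<nu> ?n S2"]
        norm_triangle_ineq[of "\<nu> ?n S1" "\<nu> ?n S2"] by simp
    ultimately show ?thesis
      unfolding eq by linarith
  qed
  \<comment> \<open>A second cluster point, along the chosen indices only: near \<open>h\<close> the
    humps on \<open>S\<close> persist.\<close>
  obtain h where h: "h \<in> K"
    "\<And>F d N. finite F \<Longrightarrow> d > 0 \<Longrightarrow> \<exists>k\<ge>N. \<forall>a\<in>F. cmod (f (s (Suc k)) a - h a) < d"
    using compact_fun_cluster_point[OF K, of "\<lambda>k. f (s (Suc k))", OF f(1)] by blast
  have fin: "h (A F) = g (A F)" if F: "finite F" for F
  proof -
    obtain b where b: "F \<subseteq> {..b}"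
      using finite_nat_iff_bounded_le F by blast
    have "cmod (h (A F) - g (A F)) \<le> 0 + d" if d: "d > 0" for d
    proof -
      obtain k0 where k0: "e / 8 / (d / 2) < real k0"
        using reals_Archimedean2 by blast
      have "\<exists>k\<ge>max b k0. \<forall>a\<in>{A F}. cmod (f (s (Suc k)) a - h a) < d / 2"
        by (rule h(2)) (use d in auto)
      then obtain k where k: "k \<ge> max b k0" "cmod (f (s (Suc k)) (A F) - h (A F)) < d / 2"
        by blast
      have "F \<subseteq> {..s k}"
        using b k(1) s_ge[of k] by fastforce
      then have "cmod (\<nu> (s (Suc k)) F) < e / (8 * (real (s k) + 1))"
        unfolding s_Suc by (rule nx(4))
      also have "\<dots> \<le> e / (8 * (real k0 + 1))"
        using e k(1) s_ge[of k] by (intro divide_left_mono mult_left_mono) auto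
      also have "\<dots> \<le> d / 2"
        using k0 d by (simp add: field_simps)
      finally have "cmod (f (s (Suc k)) (A F) - g (A F)) < d / 2"
        by (simp add: \<nu>_def)
      then show ?thesis
        using norm_triangle_ineq4[of "f (s (Suc k)) (A F) - g (A F)" "f (s (Suc k)) (A F) - h (A F)"] k(2)
        by simp
    qed
    then have "cmod (h (A F) - g (A F)) \<le> 0"
      by (rule field_le_epsilon)
    then show ?thesis
      by simp
  qed
  have "\<exists>k\<ge>0. \<forall>a\<in>{A S}. cmod (f (s (Suc k)) a - h a) < e / 8"
    by (rule h(2)) (use e in auto)
  then obtain k where k: "cmod (f (s (Suc k)) (A S) - h (A S)) < e / 8"
    by blast
  have "e / 4 < cmod (f (s (Suc k)) (A S) - g (A S))"
    using big[of k] by (simp add: \<nu>_def)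
  then have far: "e / 8 < cmod (h (A S) - g (A S))"
    using k norm_triangle_ineq[of "f (s (Suc k)) (A S) - h (A S)" "h (A S) - g (A S)"] by simp
  \<comment> \<open>On the tail of \<open>S\<close> both values are below \<open>e / 16\<close>, and
    on the finite rest \<open>h\<close> and \<open>g\<close> agree; together this contradicts the
    distance \<open>e / 8\<close> at \<open>S\<close>.\<close>
  obtain N1 where N1: "\<And>S. S \<subseteq> {N1..} \<Longrightarrow> cmod (h (A S)) < e / 16"
    using tail[OF h(1), of "e / 16"] e by auto
  obtain N2 where N2: "\<And>S. S \<subseteq> {N2..} \<Longrightarrow> cmod (g (A S)) < e / 16"
    using tail[OF g(1), of "e / 16"] e by auto
  define N where "N = max N1 N2"
  define S1 where "S1 = S \<inter> {..<N}"
  define S2 where "S2 = S \<inter> {N..}"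
  have S: "S = S1 \<union> S2" "S1 \<inter> S2 = {}"
    by (auto simp: S1_def S2_def)
  have "h (A S) - g (A S) = (h (A S1) - g (A S1)) + (h (A S2) - g (A S2))"
    unfolding S(1) add[OF h(1) S(2)] add[OF g(1) S(2)] by simp
  also have "h (A S1) - g (A S1) = 0"
    using fin[of S1] by (simp add: S1_def)
  finally have "cmod (h (A S) - g (A S)) \<le> cmod (h (A S2)) + cmod (g (A S2))"
    by (simp add: norm_triangle_ineq4)
  moreover have "S2 \<subseteq> {N1..}" "S2 \<subseteq> {N2..}"
    by (auto simp: S2_def N_def)
  then have "cmod (h (A S2)) < e / 16" "cmod (g (A S2)) < e / 16"
    using N1 N2 by blast+
  ultimately show False
    using far by linarith
qed

subsection \<open>Block diagonal operators\<close>

text \<open>By Pythagoras the squared distance of two terms is the difference of their squared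
  norms, and these form a bounded increasing sequence.\<close>

lemma Cauchy_increasing_proj:
  fixes F :: "nat \<Rightarrow> 'h::chilbert_space set"
  assumes on: "\<And>n. orthonormal (F n)" and mono: "\<And>m n. m \<le> n \<Longrightarrow> F m \<subseteq> F n"
  shows "Cauchy (\<lambda>n. bop_apply (proj (F n)) v)"
proof -
  define c where "c n = (norm (bop_apply (proj (F n)) v))\<^sup>2" for n
  have PP: "proj (F n) * proj (F m) = proj (F m)" "proj (F m) * proj (F n) = proj (F m)"
    if "m \<le> n" for m n
    using proj_times[OF on[of n] order_refl mono[OF that]] proj_times[OF on[of n] mono[OF that] order_refl]
      mono[OF that] by (simp_all add: Int_absorb1 Int_absorb2)
  have diff: "(norm (bop_apply (proj (F n)) v - bop_apply (proj (F m)) v))\<^sup>2 = c n - c m"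
    if "m \<le> n" for m n
  proof -
    have "cinner (bop_apply (proj (F m)) v) (bop_apply (proj (F n)) v - bop_apply (proj (F m)) v)
        = cinner v (bop_apply (proj (F m) * proj (F n) - proj (F m) * proj (F m)) v)"
      by (simp add: cinner_proj)
    also have "\<dots> = 0"
      using PP[OF that] PP[of m m] by simp
    finally have "(norm (bop_apply (proj (F m)) v + (bop_apply (proj (F n)) v - bop_apply (proj (F m)) v)))\<^sup>2
        = c m + (norm (bop_apply (proj (F n)) v - bop_apply (proj (F m)) v))\<^sup>2"
      unfolding c_def by (rule pythagoras)
    then show ?thesis
      by (simp add: c_def)
  qed
  have "incseq c"
  proof (rule incseq_SucI)
    show "c n \<le> c (Suc n)" for n
      using diff[of n "Suc n"] zero_le_power2[of "norm (bop_apply (proj (F (Suc n))) v - bop_apply (proj (F n)) v)"]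
      by linarith
  qed
  moreover have "c n \<le> (norm v)\<^sup>2" for n
    unfolding c_def by (intro power_mono norm_proj_apply_le on) auto
  ultimately have "convergent c"
    using incseq_convergent convergentI by metis
  then have "Cauchy c"
    by (rule convergent_Cauchy)
  show ?thesis
  proof (rule CauchyI')
    fix e :: real
    assume e: "e > 0"
    then obtain N where N: "\<And>m n. m \<ge> N \<Longrightarrow> n \<ge> N \<Longrightarrow> norm (c m - c n) < e\<^sup>2"
      using CauchyD[OF \<open>Cauchy c\<close>, of "e\<^sup>2"] by auto
    have "norm (bop_apply (proj (F m)) v - bop_apply (proj (F n)) v) < e" if "m \<ge> N" "n > m" for m n
    proof -
      have "(norm (bop_apply (proj (F n)) v - bop_apply (proj (F m)) v))\<^sup>2 < e\<^sup>2"
        using diff[of m n] N[of n m] that by (simp add: abs_less_iff)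
      then have "norm (bop_apply (proj (F n)) v - bop_apply (proj (F m)) v) < e"
        by (rule power2_less_imp_less) (use e in simp)
      then show ?thesis
        by (simp add: norm_minus_commute)
    qed
    then show "\<exists>M. \<forall>m\<ge>M. \<forall>n>m. dist (bop_apply (proj (F m)) v) (bop_apply (proj (F n)) v) < e"
      unfolding dist_norm by blast
  qed
qed

text \<open>\<open>T S\<close> is the pointwise limit of the sums of \<open>A n\<close> over
  \<open>n \<in> S\<close>, which need not converge in norm. In the last conclusion the sets
  \<open>S n\<close> are unrelated to each other: refuting a uniform tail bound produces one bad set
  per index.\<close>

lemma block_diagonal_operators:
  fixes F :: "nat \<Rightarrow> 'h::chilbert_space set" and A :: "nat \<Rightarrow> 'h bop"
  assumes on: "\<And>n. orthonormal (F n)" and F_Suc: "\<And>n. F n \<subseteq> F (Suc n)"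
    and nA: "\<And>n. norm (A n) \<le> 1"
    and A0: "\<And>n. proj (F n) * A n = 0" "\<And>n. A n * proj (F n) = 0"
    and A1: "\<And>n. proj (F (Suc n)) * A n = A n" "\<And>n. A n * proj (F (Suc n)) = A n"
  shows "\<exists>T. (\<forall>n. T {n} = A n) \<and> (\<forall>S S'. S \<inter> S' = {} \<longrightarrow> T (S \<union> S') = T S + T S') \<and>
    (\<forall>S. (\<forall>n. S n \<subseteq> {n..}) \<longrightarrow> filterlim (\<lambda>n. T (S n)) strong_star_at_0 sequentially)"
proof -
  define P where "P n = proj (F n)" for n
  have mono: "F m \<subseteq> F n" if "m \<le> n" for m n
    using F_Suc that by (rule lift_Suc_mono_le)
  have PP: "P n * P m = P m" "P m * P n = P m" if "m \<le> n" for m n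
    using proj_times[OF on[of n] order_refl mono[OF that]] proj_times[OF on[of n] mono[OF that] order_refl]
      mono[OF that] by (simp_all add: P_def Int_absorb1 Int_absorb2)
  have PA0: "P m * A n = 0" "A n * P m = 0" if "m \<le> n" for m n
  proof -
    have "P m * A n = P m * (P n * A n)"
      using PP[OF that] by (simp add: mult.assoc[symmetric])
    then show "P m * A n = 0"
      using A0 by (simp add: P_def)
    have "A n * P m = (A n * P n) * P m"
      using PP[OF that] by (simp add: mult.assoc)
    then show "A n * P m = 0"
      using A0 by (simp add: P_def)
  qed
  have PA1: "P m * A n = A n" "A n * P m = A n" if "n < m" for m n
  proof -
    have le: "Suc n \<le> m"
      using that by simp
    have "P m * A n = P m * P (Suc n) * A n"
      using A1 by (simp add: P_def mult.assoc)
    then show "P m * A n = A n"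
      using PP[OF le] A1 by (simp add: P_def)
    have "A n * P m = A n * (P (Suc n) * P m)"
      using A1 by (simp add: P_def mult.assoc[symmetric])
    then show "A n * P m = A n"
      using PP[OF le] A1 by (simp add: P_def)
  qed
  define X where "X S M = (\<Sum>n\<in>S \<inter> {..<M}. A n)" for S M
  have PX: "P M * X S M = X S M" "X S M * P M = X S M" for S M
    using PA1 by (auto simp: X_def sum_distrib_left sum_distrib_right intro!: sum.cong)
  have PX0: "P N * X S M = 0" "X S M * P N = 0" if "S \<subseteq> {N..}" for S M N
    using that PA0 by (auto simp: X_def sum_distrib_left sum_distrib_right intro!: sum.neutral)
  have X_Suc: "X S (Suc M) = X S M + (if M \<in> S then A M else 0)" for S M
  proof -
    have "S \<inter> {..<Suc M} = (if M \<in> S then insert M (S \<inter> {..<M}) else S \<inter> {..<M})"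
      by (auto simp: less_Suc_eq)
    then show ?thesis
      by (simp add: X_def add.commute)
  qed
  \<comment> \<open>Bounding by \<open>P M\<close> instead of the norm of \<open>x\<close> makes the
    induction work: the new summand is orthogonal to the old sum, and \<open>A M\<close> sees only
    the increment \<open>D\<close> of the projections.\<close>
  have X_le_P: "norm (bop_apply (X S M) x) \<le> norm (bop_apply (P M) x)" for S M x
  proof (induction M)
    case 0
    then show ?case
      by (simp add: X_def)
  next
    case (Suc M)
    define y where "y = bop_apply (X S M) x"
    define z where "z = bop_apply (if M \<in> S then A M else 0) x"
    define D where "D = bop_apply (P (Suc M) - P M) x"
    have Pz: "bop_apply (P M) z = 0"
      using arg_cong[OF PA0(1)[of M M], of "\<lambda>B. bop_apply B x"] by (simp add: z_def)
    have "bop_apply (P M) y = y"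
      using arg_cong[OF PX(1)[of M S], of "\<lambda>B. bop_apply B x"] by (simp add: y_def)
    then have "cinner y z = cinner y (bop_apply (P M) z)"
      by (metis P_def cinner_proj)
    then have "cinner y z = 0"
      by (simp add: Pz)
    then have "(norm (y + z))\<^sup>2 = (norm y)\<^sup>2 + (norm z)\<^sup>2"
      by (rule pythagoras)
    also have "\<dots> \<le> (norm (bop_apply (P M) x))\<^sup>2 + (norm D)\<^sup>2"
    proof (intro add_mono power_mono)
      show "norm y \<le> norm (bop_apply (P M) x)"
        using Suc by (simp add: y_def)
      have "bop_apply (A M) x = bop_apply (A M * P (Suc M) - A M * P M) x"
        using PA0[of M M] PA1[of M "Suc M"] by simp
      also have "\<dots> = bop_apply (A M) D"
        by (simp add: D_def)
      finally have "norm (bop_apply (A M) x) \<le> norm (A M) * norm D"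
        by (simp add: norm_bop_apply)
      also have "\<dots> \<le> 1 * norm D"
        by (intro mult_right_mono nA) auto
      finally show "norm z \<le> norm D"
        by (simp add: z_def)
    qed auto
    also have "\<dots> = (norm (bop_apply (P M) x + D))\<^sup>2"
    proof (rule pythagoras[symmetric])
      have "cinner (bop_apply (P M) x) D = cinner x (bop_apply (P M * P (Suc M) - P M * P M) x)"
        by (simp add: P_def cinner_proj D_def)
      also have "\<dots> = 0"
        using PP[of M "Suc M"] PP[of M M] by simp
      finally show "cinner (bop_apply (P M) x) D = 0" .
    qed
    also have "bop_apply (P M) x + D = bop_apply (P (Suc M)) x"
      by (simp add: D_def)
    finally have "(norm (y + z))\<^sup>2 \<le> (norm (bop_apply (P (Suc M)) x))\<^sup>2" .
    then have "norm (y + z) \<le> norm (bop_apply (P (Suc M)) x)"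
      by (rule power2_le_imp_le) simp
    then show ?case
      by (simp add: X_Suc y_def z_def)
  qed
  have X_le: "norm (bop_apply (X S M) x) \<le> norm x" for S M x
    using X_le_P[of S M x] norm_proj_apply_le[OF on, of M x] unfolding P_def by linarith
  \<comment> \<open>To the right of \<open>X S M\<close> the projection \<open>P M\<close> changes
    nothing and \<open>P N\<close> gives 0, so \<open>x\<close> may be replaced by its part between
    them.\<close>
  have X_tail: "norm (bop_apply (X S M) x) \<le> norm (bop_apply (P M) x - bop_apply (P N) x)"
    if "S \<subseteq> {N..}" "N \<le> M" for S M N x
  proof -
    have "bop_apply (X S M) x = bop_apply (X S M * P M - X S M * P N) x"
      using PX PX0[OF that(1)] by simp
    also have "\<dots> = bop_apply (X S M) (bop_apply (P M - P N) x)"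
      by simp
    finally have eq: "bop_apply (X S M) x = bop_apply (X S M) (bop_apply (P M - P N) x)" .
    have "norm (bop_apply (X S M) x) \<le> norm (bop_apply (P M) (bop_apply (P M - P N) x))"
      by (subst eq) (rule X_le_P)
    also have "bop_apply (P M) (bop_apply (P M - P N) x) = bop_apply (P M * P M - P M * P N) x"
      by simp
    also have "\<dots> = bop_apply (P M) x - bop_apply (P N) x"
      using PP[of M M] PP[OF that(2)] by simp
    finally show ?thesis .
  qed
  have CP: "Cauchy (\<lambda>n. bop_apply (P n) v)" for v
    unfolding P_def by (rule Cauchy_increasing_proj[OF on mono])
  have "Cauchy (\<lambda>M. bop_apply (X S M) x)" for S x
  proof (rule CauchyI')
    fix e :: real
    assume "e > 0"
    then obtain N where N: "\<And>m n. m \<ge> N \<Longrightarrow> n \<ge> N \<Longrightarrow> norm (bop_apply (P m) x - bop_apply (P n) x) < e"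
      using CauchyD[OF CP] by metis
    have "norm (bop_apply (X S m) x - bop_apply (X S n) x) < e" if "m \<ge> N" "n > m" for m n
    proof -
      have "X S n = X S m + X (S \<inter> {m..}) n"
      proof -
        have eq: "S \<inter> {..<n} = (S \<inter> {..<m}) \<union> (S \<inter> {m..} \<inter> {..<n})"
          using that by auto
        show ?thesis
          unfolding X_def by (subst eq, rule sum.union_disjoint) auto
      qed
      then have "norm (bop_apply (X S m) x - bop_apply (X S n) x) = norm (bop_apply (X (S \<inter> {m..}) n) x)"
        by simp
      also have "\<dots> \<le> norm (bop_apply (P n) x - bop_apply (P m) x)"
        using that by (intro X_tail) auto
      also have "\<dots> < e"
        using that by (intro N) auto
      finally show ?thesis .
    qed
    then show "\<exists>M. \<forall>m\<ge>M. \<forall>n>m. dist (bop_apply (X S m) x) (bop_apply (X S n) x) < e"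
      unfolding dist_norm by blast
  qed
  then have "\<exists>B. \<forall>x. (\<lambda>M. bop_apply (X S M) x) \<longlonglongrightarrow> bop_apply B x" for S
    using pointwise_limit_bop[of "X S"] by metis
  then obtain T where T: "\<And>S x. (\<lambda>M. bop_apply (X S M) x) \<longlonglongrightarrow> bop_apply (T S) x"
    by metis
  have T1: "T {n} = A n" for n
  proof (rule bop_eqI)
    fix x
    have "eventually (\<lambda>M. bop_apply (X {n} M) x = bop_apply (A n) x) sequentially"
      using eventually_gt_at_top[of n] by eventually_elim (simp add: X_def)
    then show "bop_apply (T {n}) x = bop_apply (A n) x"
      by (intro LIMSEQ_unique[OF T]) (rule tendsto_eventually)
  qed
  have T2: "T (S \<union> S') = T S + T S'" if "S \<inter> S' = {}" for S S'
  proof (rule bop_eqI)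
    fix x
    have "X (S \<union> S') M = X S M + X S' M" for M
      unfolding X_def Int_Un_distrib2 using that by (intro sum.union_disjoint) auto
    then have "(\<lambda>M. bop_apply (X (S \<union> S') M) x) \<longlonglongrightarrow> bop_apply (T S + T S') x"
      using tendsto_add[OF T[of S x] T[of S' x]] by simp
    then show "bop_apply (T (S \<union> S')) x = bop_apply (T S + T S') x"
      by (rule LIMSEQ_unique[OF T])
  qed
  \<comment> \<open>For the adjoint no limit of adjoints is taken. The range of \<open>X S M\<close>
    is fixed by \<open>P M\<close> and annihilated by \<open>P N\<close>, so inside a scalar product
    both projections move over to \<open>v\<close>.\<close>
  have T_small: "norm (bop_apply (T S) v) \<le> r \<and> norm (adj (T S) v) \<le> r"
    if S: "S \<subseteq> {N..}" and r: "\<And>M. M \<ge> N \<Longrightarrow> norm (bop_apply (P M) v - bop_apply (P N) v) \<le> r"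
    for S N v r
  proof
    show "norm (bop_apply (T S) v) \<le> r"
      by (rule norm_le_of_pointwise_limit[OF T, of N]) (use X_tail[OF S] r order_trans in blast)
    show "norm (adj (T S) v) \<le> r"
    proof (rule norm_le_of_cinner)
      show "0 \<le> r"
        using r[of N] by simp
      fix z
      have le: "cmod (cinner (bop_apply (X S M) z) v) \<le> r * norm z" if M: "M \<ge> N" for M
      proof -
        let ?y = "bop_apply (X S M) z"
        have "bop_apply (P M) ?y = ?y" "bop_apply (P N) ?y = 0"
          using arg_cong[OF PX(1)[of M S], of "\<lambda>B. bop_apply B z"]
            arg_cong[OF PX0(1)[OF S, of M], of "\<lambda>B. bop_apply B z"] by simp_all
        then have "cinner ?y v = cinner (bop_apply (P M) ?y) v - cinner (bop_apply (P N) ?y) v"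
          by simp
        also have "\<dots> = cinner ?y (bop_apply (P M) v - bop_apply (P N) v)"
          by (simp only: P_def cinner_proj cinner_diff_right)
        also have "cmod \<dots> \<le> norm (bop_apply (X S M) z) * norm (bop_apply (P M) v - bop_apply (P N) v)"
          by (rule cmod_cinner_le)
        also have "\<dots> \<le> norm z * r"
          by (intro mult_mono X_le r M) auto
        finally show ?thesis
          by (simp add: mult.commute)
      qed
      have "(\<lambda>M. cinner (bop_apply (X S M) z) v) \<longlonglongrightarrow> cinner (bop_apply (T S) z) v"
        by (rule bounded_linear.tendsto[OF bounded_linear_cinner_left T])
      then have "cmod (cinner (bop_apply (T S) z) v) \<le> r * norm z"
        by (intro LIMSEQ_le_const2[OF tendsto_norm]) (use le in blast)+
      then show "cmod (cinner z (adj (T S) v)) \<le> r * norm z"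
        by (simp add: cinner_adj)
    qed
  qed
  have T3: "filterlim (\<lambda>n. T (S n)) strong_star_at_0 sequentially" if S: "\<And>n. S n \<subseteq> {n..}" for S
  proof (rule filterlim_strong_star)
    have "norm (T S) \<le> 1" for S
      by (rule norm_bop_bound) (auto intro!: norm_le_of_pointwise_limit[OF T, of 0] X_le)
    then show "eventually (\<lambda>n. norm (T (S n)) \<le> 1) sequentially"
      by simp
    fix v
    show "(\<lambda>n. norm (bop_apply (T (S n)) v) + norm (adj (T (S n)) v)) \<longlonglongrightarrow> 0"
    proof (rule LIMSEQ_I)
      fix e :: real
      assume e: "e > 0"
      then obtain N where N: "\<And>m n. m \<ge> N \<Longrightarrow> n \<ge> N \<Longrightarrow>
          norm (bop_apply (P m) v - bop_apply (P n) v) < e / 3"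
        using CauchyD[OF CP, of "e / 3" v] by auto
      have "norm (norm (bop_apply (T (S n)) v) + norm (adj (T (S n)) v) - 0) < e" if "n \<ge> N" for n
      proof -
        have "norm (bop_apply (T (S n)) v) \<le> e / 3 \<and> norm (adj (T (S n)) v) \<le> e / 3"
          by (rule T_small[OF S]) (use N that in \<open>auto intro: less_imp_le\<close>)
        then have "norm (bop_apply (T (S n)) v) + norm (adj (T (S n)) v) < e"
          using e by linarith
        then show ?thesis
          by simp
      qed
      then show "\<exists>no. \<forall>n\<ge>no. norm (norm (bop_apply (T (S n)) v) + norm (adj (T (S n)) v) - 0) < e"
        by blast
    qed
  qed
  show ?thesis
    using T1 T2 T3 by (intro exI[of _ T]) blast
qed

subsection \<open>Compact sets in the dual of the strict topology\<close>

lemma strict_dual: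
  fixes f :: "'h::chilbert_space bop \<Rightarrow> complex"
  assumes "f \<in> continuous_dual strict_topology"
  shows "clinear f" "bounded_linear f" "cseminorm (\<lambda>A. cmod (f A))"
    "((\<lambda>A. cmod (f A)) \<longlongrightarrow> 0) strong_star_at_0"
proof -
  show lin: "clinear f"
    using assms by (simp add: continuous_dual_def)
  show sn: "cseminorm (\<lambda>A. cmod (f A))"
    by (rule cseminorm_cmod[OF lin])
  have "continuous_map strict_topology euclidean (norm \<circ> f)"
  proof (rule continuous_map_compose)
    show "continuous_map strict_topology euclidean f"
      using assms by (simp add: continuous_dual_def)
    show "continuous_map euclidean euclidean (norm :: complex \<Rightarrow> real)"
      by (simp add: continuous_on_norm_id)
  qed
  then have cont: "continuous_map strict_topology euclidean (\<lambda>A. cmod (f A))"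
    by (simp add: o_def)
  show "((\<lambda>A. cmod (f A)) \<longlongrightarrow> 0) strong_star_at_0"
    by (rule strict_continuous_imp(1)[OF sn cont])
  obtain C where C: "\<And>A. cmod (f A) \<le> C * norm A"
    using strict_continuous_imp(2)[OF sn cont] by blast
  show "bounded_linear f"
  proof (rule bounded_linear_intro[of _ C])
    show "f (A + B) = f A + f B" for A B
      using lin by (simp add: clinear_iff)
    show "f (r *\<^sub>R A) = r *\<^sub>R f A" for r A
      using lin by (simp add: clinear_iff scaleR_scaleC)
    show "norm (f A) \<le> norm A * C" for A
      using C[of A] by (simp add: mult.commute)
  qed
qed

text \<open>The adjoint half says that the range of \<open>A\<close> is orthogonal to
  \<open>F\<close>, that is, \<open>proj F * A = 0\<close>.\<close>

lemma vanishes_on_orthonormal_iff: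
  assumes "orthonormal F"
  shows "vanishes_on A F \<longleftrightarrow> proj F * A = 0 \<and> A * proj F = 0"
proof
  assume A: "vanishes_on A F"
  have "bop_apply (proj F) (bop_apply A x) = 0" for x
    using A by (simp add: proj_apply vanishes_on_def cinner_adj)
  moreover have "bop_apply A (bop_apply (proj F) x) = 0" for x
    using A by (simp add: proj_apply vanishes_on_def bop_apply_sum_right scaleC_zero)
  ultimately show "proj F * A = 0 \<and> A * proj F = 0"
    by (auto intro!: bop_eqI)
next
  assume A: "proj F * A = 0 \<and> A * proj F = 0"
  show "vanishes_on A F"
    unfolding vanishes_on_def
  proof
    fix e
    assume "e \<in> F"
    then have e: "bop_apply (proj F) e = e"
      using proj_basis[OF assms order_refl] by simp
    have "bop_apply (A * proj F) e = 0"
      by (simp add: A)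
    moreover have "adj (proj F * A) e = 0"
      by (rule adj_eqI) (simp add: A)
    ultimately show "bop_apply A e = 0 \<and> adj A e = 0"
      by (simp add: adj_times e)
  qed
qed

text \<open>Makes room for the next block: a bad operator is compressed to finitely many dimensions
  on both sides and stays bad, because \<open>f\<close> hardly sees the difference.\<close>

lemma strict_dual_cutoff:
  fixes f :: "'h::chilbert_space bop \<Rightarrow> complex"
  assumes f: "f \<in> continuous_dual strict_topology" and F: "orthonormal F"
    and A: "norm A \<le> 1" "vanishes_on A F" "e < cmod (f A)"
  shows "\<exists>G A'. orthonormal G \<and> F \<subseteq> G \<and> norm A' \<le> 1 \<and> vanishes_on A' F \<and>
    proj G * A' = A' \<and> A' * proj G = A' \<and> e < cmod (f A')"
proof -
  interpret f: bounded_linear f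
    by (rule strict_dual(2)[OF f])
  define d where "d = cmod (f A) - e"
  have d: "d > 0"
    using A(3) by (simp add: d_def)
  \<comment> \<open>The difference \<open>A - A'\<close> has norm at most 2, so \<open>d / 4\<close>
    costs only half of the margin \<open>d\<close>.\<close>
  obtain V where V: "finite V" "\<And>X. vanishes_on X V \<Longrightarrow> cmod (f X) \<le> d / 4 * norm X"
    using strong_star_small_off_finite[OF strict_dual(3,4)[OF f], of "d / 4"] d by auto
  \<comment> \<open>\<open>Q\<close> must fix \<open>V\<close> and also the images of
    \<open>V\<close> under \<open>A\<close> and its adjoint; then \<open>Q * A * Q\<close> agrees
    with \<open>A\<close> on \<open>V\<close>, and likewise the adjoints.\<close>
  define W where "W = V \<union> bop_apply A ` V \<union> adj A ` V"
  have "finite W"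
    using V(1) by (simp add: W_def)
  then obtain G where G: "orthonormal G" "F \<subseteq> G" "\<forall>v\<in>W. bop_apply (proj G) v = v"
    using orthonormal_extend[OF _ F] by metis
  define Q where "Q = proj G"
  define A' where "A' = Q * A * Q"
  have QQ: "Q * Q = Q"
    unfolding Q_def by (rule proj_idem[OF G(1)])
  have "norm A' \<le> norm (Q * A) * norm Q"
    unfolding A'_def by (rule norm_bop_times)
  also have "\<dots> \<le> norm (Q * A) * 1"
    unfolding Q_def by (intro mult_left_mono norm_proj_le G) auto
  also have "\<dots> \<le> norm Q * norm A"
    using norm_bop_times[of Q A] by simp
  also have "\<dots> \<le> 1 * 1"
    unfolding Q_def by (intro mult_mono norm_proj_le G A) auto
  finally have nA': "norm A' \<le> 1"
    by simp
  have "vanishes_on A' F"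
  proof -
    have PA: "proj F * A = 0" "A * proj F = 0"
      using A(2) by (simp_all add: vanishes_on_orthonormal_iff[OF F])
    have PQ: "proj F * Q = proj F" "Q * proj F = proj F"
      using proj_times[OF G(1) G(2) order_refl] proj_times[OF G(1) order_refl G(2)] G(2)
      by (simp_all add: Q_def Int_absorb1 Int_absorb2)
    have "proj F * A' = (proj F * Q) * A * Q"
      by (simp only: A'_def mult.assoc)
    also have "\<dots> = 0"
      by (simp only: PQ PA mult_zero_left)
    finally have 1: "proj F * A' = 0" .
    have "A' * proj F = Q * (A * (Q * proj F))"
      by (simp only: A'_def mult.assoc)
    also have "\<dots> = 0"
      by (simp only: PQ PA mult_zero_right)
    finally show ?thesis
      using 1 by (simp add: vanishes_on_orthonormal_iff[OF F])
  qed
  moreover have "Q * A' = A'"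
  proof -
    have "Q * A' = (Q * Q) * A * Q"
      by (simp only: A'_def mult.assoc)
    then show ?thesis
      by (simp only: QQ A'_def)
  qed
  moreover have "A' * Q = A'"
    by (simp only: A'_def mult.assoc QQ)
  moreover have "e < cmod (f A')"
  proof -
    have "vanishes_on (A - A') V"
      unfolding vanishes_on_def
    proof
      fix v
      assume v: "v \<in> V"
      then have "bop_apply Q v = v" "bop_apply Q (bop_apply A v) = bop_apply A v"
        "bop_apply Q (adj A v) = adj A v"
        using G(3) by (simp_all add: Q_def W_def)
      then show "bop_apply (A - A') v = 0 \<and> adj (A - A') v = 0"
        by (simp add: A'_def adj_diff adj_times) (simp add: Q_def)
    qed
    then have "cmod (f (A - A')) \<le> d / 4 * norm (A - A')"
      by (rule V(2))
    also have "\<dots> \<le> d / 4 * 2"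
      using norm_triangle_ineq4[of A A'] nA' A(1) d by (intro mult_left_mono) auto
    finally have "cmod (f A - f A') \<le> d / 2"
      by (simp add: f.diff)
    then show ?thesis
      using norm_triangle_ineq2[of "f A" "f A'"] d by (simp add: d_def field_simps)
  qed
  ultimately show ?thesis
    using nA' G(1,2) unfolding Q_def by blast
qed

lemma compact_dual_small_off_finite:
  fixes K :: "('h::chilbert_space bop \<Rightarrow> complex) set"
  assumes K: "compact K" "K \<subseteq> continuous_dual strict_topology" and e: "e > 0"
  shows "\<exists>V. finite V \<and> (\<forall>f\<in>K. \<forall>A. vanishes_on A V \<longrightarrow> cmod (f A) \<le> e * norm A)"
proof (rule ccontr)
  assume no: "\<not> ?thesis"
  \<comment> \<open>\<open>F\<close> is what has been used up, \<open>G\<close> what is used up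
    after the block \<open>A\<close>; iterating from the empty set puts the blocks between
    consecutive sets.\<close>
  define ok where "ok F G A f \<longleftrightarrow> f \<in> K \<and> orthonormal G \<and> F \<subseteq> G \<and> norm A \<le> 1 \<and>
    vanishes_on A F \<and> proj G * A = A \<and> A * proj G = A \<and> e < cmod (f A)"
    for F G :: "'h set" and A f
  have "\<exists>G A f. ok F G A f" if F: "orthonormal F" for F
  proof -
    have "finite F"
      using F by (simp add: orthonormal_def)
    then obtain f A where f: "f \<in> K" and A: "vanishes_on A F" "e * norm A < cmod (f A)"
      using no by (auto simp: not_le)
    have fd: "f \<in> continuous_dual strict_topology"
      using f K by blast
    interpret f: bounded_linear f
      by (rule strict_dual(2)[OF fd])
    have "A \<noteq> 0"
      using A(2) by (auto simp: f.zero)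
    define A1 where "A1 = (1 / norm A) *\<^sub>R A"
    have "norm A1 \<le> 1"
      using \<open>A \<noteq> 0\<close> by (simp add: A1_def)
    moreover have "vanishes_on A1 F"
      using A(1) by (simp add: vanishes_on_def A1_def adj_scaleR)
    moreover have "e < cmod (f A1)"
      using A(2) \<open>A \<noteq> 0\<close> by (simp add: A1_def f.scaleR field_simps)
    ultimately show ?thesis
      using strict_dual_cutoff[OF fd F, of A1 e] f unfolding ok_def by blast
  qed
  then obtain g a h where gah: "\<And>F. orthonormal F \<Longrightarrow> ok F (g F) (a F) (h F)"
    by metis
  define F where "F n = (g ^^ n) {}" for n
  have F_Suc: "F (Suc n) = g (F n)" for n
    by (simp add: F_def)
  have on: "orthonormal (F n)" for n
  proof (induction n)
    case 0
    then show ?case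
      by (simp add: F_def orthonormal_def)
  next
    case (Suc n)
    then show ?case
      using gah[of "F n"] by (simp add: F_Suc ok_def)
  qed
  define A where "A n = a (F n)" for n
  have ok: "ok (F n) (F (Suc n)) (A n) (h (F n))" for n
    using gah[OF on] by (simp add: F_Suc A_def)
  have *: "F n \<subseteq> F (Suc n)" "norm (A n) \<le> 1" "proj (F n) * A n = 0" "A n * proj (F n) = 0"
    "proj (F (Suc n)) * A n = A n" "A n * proj (F (Suc n)) = A n" for n
    using ok[of n] vanishes_on_orthonormal_iff[OF on[of n]] unfolding ok_def by blast+
  obtain T where T: "\<And>n. T {n} = A n" "\<And>S S'. S \<inter> S' = {} \<Longrightarrow> T (S \<union> S') = T S + T S'"
    "\<And>S. (\<And>n. S n \<subseteq> {n..}) \<Longrightarrow> filterlim (\<lambda>n. T (S n)) strong_star_at_0 sequentially"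
    using block_diagonal_operators[of F A, OF on *] by blast
  have "\<exists>n. \<forall>f\<in>K. cmod (f (T {n})) \<le> e"
  proof (rule compact_additive_uniformly_small[OF K(1) _ _ e])
    fix f and S S' :: "nat set"
    assume "f \<in> K" "S \<inter> S' = {}"
    then show "f (T (S \<union> S')) = f (T S) + f (T S')"
      using strict_dual(1) K(2) by (auto simp: T(2) clinear_iff)
  next
    fix f and d :: real
    assume f: "f \<in> K" and d: "d > 0"
    show "\<exists>N. \<forall>S. S \<subseteq> {N..} \<longrightarrow> cmod (f (T S)) < d"
    proof (rule ccontr)
      assume "\<not> ?thesis"
      then have "\<forall>N. \<exists>S. S \<subseteq> {N..} \<and> d \<le> cmod (f (T S))"
        by (auto simp: not_less)
      then obtain S where S: "\<And>N. S N \<subseteq> {N..}" "\<And>N. d \<le> cmod (f (T (S N)))"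
        by metis
      have fd: "f \<in> continuous_dual strict_topology"
        using f K by blast
      \<comment> \<open>Continuity of the single functional \<open>f\<close> suffices: the operators
        \<open>T (S n)\<close> tend to 0 in the strong* sense inside the unit ball.\<close>
      have "(\<lambda>n. cmod (f (T (S n)))) \<longlonglongrightarrow> 0"
        by (rule filterlim_compose[OF strict_dual(4)[OF fd] T(3)[OF S(1)]])
      then have "d \<le> 0"
        by (rule LIMSEQ_le_const) (use S(2) in blast)
      then show False
        using d by simp
    qed
  qed
  then obtain n where "\<And>f. f \<in> K \<Longrightarrow> cmod (f (A n)) \<le> e"
    by (auto simp: T(1))
  then show False
    using ok[of n] unfolding ok_def by (meson not_le)
qed

section \<open>Equicontinuity and the strong Mackey property\<close>

lemma equicontinuous_in_strict:
  fixes K :: "('h::chilbert_space bop \<Rightarrow> complex) set"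
  assumes K: "\<And>f. f \<in> K \<Longrightarrow> clinear f" and B: "compact_bop B" and c: "0 \<le> c"
    and le: "\<And>f A. f \<in> K \<Longrightarrow> cmod (f A) \<le> c * (norm (A * B) + norm (B * A))"
  shows "equicontinuous_in strict_topology K"
  unfolding equicontinuous_in_def
proof (intro ballI allI impI)
  fix x :: "'h bop" and e :: real
  assume e: "e > 0"
  define d where "d = e / (2 * c + 1)"
  have d: "d > 0"
    using e c by (simp add: d_def)
  define Q where "Q = {\<lambda>A. norm (A * B), \<lambda>A. norm (B * A)}"
  have Q: "finite Q" "Q \<subseteq> strict_seminorms"
    using strict_seminormsI[OF B] by (auto simp: Q_def)
  have "dist (f y) (f x) < e" if f: "f \<in> K" and y: "y \<in> seminorm_ball Q x d" for f y
  proof -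
    have "f (y - x) = f y - f x"
    proof -
      have "f (y - x + x) = f (y - x) + f x"
        using K[OF f] by (simp only: clinear_iff)
      then show ?thesis
        by simp
    qed
    then have "dist (f y) (f x) \<le> c * (norm ((y - x) * B) + norm (B * (y - x)))"
      using le[OF f, of "y - x"] by (simp add: dist_norm)
    also have "\<dots> \<le> c * (d + d)"
      using y c by (intro mult_left_mono add_mono) (auto simp: seminorm_ball_def Q_def)
    also have "\<dots> < (2 * c + 1) * d"
      using d by (simp add: algebra_simps)
    also have "\<dots> = e"
      using c by (simp add: d_def)
    finally show ?thesis .
  qed
  then show "\<exists>U. openin strict_topology U \<and> x \<in> U \<and> (\<forall>f\<in>K. \<forall>y\<in>U. dist (f y) (f x) < e)"
    using openin_seminorm_ball[OF strict_seminorms_facts Q d]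
      mem_seminorm_ball[OF strict_seminorms_facts Q(2) d]
    unfolding strict_topology_eq by (intro exI[of _ "seminorm_ball Q x d"]) auto
qed

lemma strong_Mackey_strict: "strong_Mackey (strict_topology :: 'h::chilbert_space bop topology)"
  unfolding strong_Mackey_def
proof (intro conjI allI impI)
  show "locally_convex_space (strict_topology :: 'h bop topology)"
    unfolding strict_topology_eq by (rule locally_convex_seminorm_topology[OF strict_seminorms_facts])
  fix K :: "('h bop \<Rightarrow> complex) set"
  assume "compactin (weak_dual_topology strict_topology) K"
  then have K: "compact K" "K \<subseteq> continuous_dual strict_topology"
    unfolding weak_dual_topology_def compactin_subtopology euclidean_product_topology by auto
  \<comment> \<open>Evaluation at \<open>A\<close> is continuous on \<open>K\<close>, so
    \<open>K\<close> is pointwise bounded, and Banach-Steinhaus supplies the common constant that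
    the domination needs.\<close>
  have "\<exists>c. \<forall>f\<in>K. cmod (f A) \<le> c" for A
  proof -
    have "compact ((\<lambda>f. f A) ` K)"
      using K(1) by (intro compact_continuous_image continuous_on_subset[OF continuous_on_product_coordinates]) auto
    then have "bounded ((\<lambda>f. f A) ` K)"
      by (rule compact_imp_bounded)
    then show ?thesis
      by (auto simp: bounded_iff)
  qed
  then obtain C where C: "C > 0" "\<And>f A. f \<in> K \<Longrightarrow> cmod (f A) \<le> C * norm A"
    using Banach_Steinhaus[of K] strict_dual(2) K(2) by (metis subsetD)
  define N where "N = (\<lambda>f A. cmod (f A)) ` K"
  have "\<exists>B c. compact_bop B \<and> 0 \<le> c \<and> (\<forall>p\<in>N. \<forall>A. p A \<le> c * (norm (A * B) + norm (B * A)))"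
  proof (rule strict_domination)
    show "cseminorm p" if "p \<in> N" for p
      using that strict_dual(3) K(2) by (auto simp: N_def)
    show "p A \<le> C * norm A" if "p \<in> N" for p A
      using that C(2) by (auto simp: N_def)
    show "0 \<le> C"
      using C(1) by simp
    show "\<exists>V. finite V \<and> (\<forall>p\<in>N. \<forall>A. vanishes_on A V \<longrightarrow> p A \<le> e * norm A)" if "e > 0" for e
      using compact_dual_small_off_finite[OF K that] by (simp add: N_def)
  qed
  then obtain B c where "compact_bop B" "0 \<le> c"
    "\<And>f A. f \<in> K \<Longrightarrow> cmod (f A) \<le> c * (norm (A * B) + norm (B * A))"
    by (auto simp: N_def)
  then show "equicontinuous_in strict_topology K"
    using strict_dual(1) K(2) by (intro equicontinuous_in_strict) auto
qed

subsection \<open>Condition C\<close>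

text \<open>Rank one operators are compact, so this lets strict seminorms control values at single
  vectors.\<close>

lemma norm_times_rank1_ge: "norm (bop_apply A x) * norm x \<le> norm (A * rank1 x x)"
proof (cases "x = 0")
  case False
  have "norm (bop_apply (A * rank1 x x) x) \<le> norm (A * rank1 x x) * norm x"
    by (rule norm_bop_apply)
  also have "norm (bop_apply (A * rank1 x x) x) = norm (bop_apply A x) * norm x * norm x"
    by (simp add: norm_scaleC cinner_self power2_eq_square norm_mult)
  finally show ?thesis
    using False by simp
qed simp

lemma rank1_strict_seminorm: "(\<lambda>A. norm (A * rank1 x x)) \<in> strict_seminorms"
  using strict_seminormsI(1)[OF compact_bop_rank1[of 1 x x]] by (simp add: scaleC_one)

section \<open>Sequential completeness\<close>

lemma strict_Cauchy_seminorm: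
  assumes "Cauchy_in strict_topology s" "q \<in> strict_seminorms" "e > 0"
  shows "\<exists>N. \<forall>m\<ge>N. \<forall>n\<ge>N. q (s m - s n) < e"
proof -
  have "openin strict_topology (seminorm_ball {q} 0 e)" "0 \<in> seminorm_ball {q} 0 e"
    using openin_seminorm_ball[OF strict_seminorms_facts, of "{q}"]
      mem_seminorm_ball[OF strict_seminorms_facts, of "{q}"] assms(2,3)
    by (auto simp: strict_topology_eq)
  then have "\<exists>N. \<forall>m\<ge>N. \<forall>n\<ge>N. s m - s n \<in> seminorm_ball {q} 0 e"
    using assms(1) by (simp add: Cauchy_in_def)
  then show ?thesis
    by (simp add: seminorm_ball_def)
qed

text \<open>Rank one seminorms make the sequence pointwise Cauchy, which gives the candidate
  \<open>A\<close>. The Cauchy estimate for each seminorm survives the pointwise limit in one index,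
  since bounds on values at vectors are closed conditions and multiplication by a fixed
  \<open>B\<close> respects pointwise limits.\<close>

lemma sequentially_complete_strict:
  "sequentially_complete (strict_topology :: 'h::chilbert_space bop topology)"
  unfolding sequentially_complete_def
proof (intro allI impI)
  fix s :: "nat \<Rightarrow> 'h bop"
  assume s: "Cauchy_in strict_topology s"
  have "Cauchy (\<lambda>n. bop_apply (s n) x)" for x
  proof (cases "x = 0")
    case True
    then show ?thesis
      by (simp add: Cauchy_def)
  next
    case False
    show ?thesis
    proof (rule CauchyI)
      fix e :: real
      assume e: "e > 0"
      obtain N where N: "\<And>m n. m \<ge> N \<Longrightarrow> n \<ge> N \<Longrightarrow> norm ((s m - s n) * rank1 x x) < e * norm x"
        using strict_Cauchy_seminorm[OF s rank1_strict_seminorm, of "e * norm x" x] e False by auto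
      have "norm (bop_apply (s m) x - bop_apply (s n) x) < e" if "m \<ge> N" "n \<ge> N" for m n
      proof -
        have "norm (bop_apply (s m - s n) x) * norm x < e * norm x"
          using norm_times_rank1_ge N[OF that] by (rule order_le_less_trans)
        then show ?thesis
          using False by simp
      qed
      then show "\<exists>M. \<forall>m\<ge>M. \<forall>n\<ge>M. norm (bop_apply (s m) x - bop_apply (s n) x) < e"
        by blast
    qed
  qed
  then obtain A where A: "\<And>x. (\<lambda>n. bop_apply (s n) x) \<longlonglongrightarrow> bop_apply A x"
    using pointwise_limit_bop[of s] by metis
  have ev: "eventually (\<lambda>n. q (s n - A) < e) sequentially" if q: "q \<in> strict_seminorms" and e: "e > 0"
    for q e
  proof -
    obtain N where N: "\<And>m n. m \<ge> N \<Longrightarrow> n \<ge> N \<Longrightarrow> q (s m - s n) < e / 2"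
      using strict_Cauchy_seminorm[OF s q, of "e / 2"] e by auto
    have "q (s n - A) \<le> e / 2" if n: "n \<ge> N" for n
      using q
    proof (cases rule: strict_seminorms_cases)
      case (1 B)
      show ?thesis
        unfolding 1(2)
      proof (rule norm_bop_bound)
        fix x
        have "(\<lambda>m. bop_apply ((s n - s m) * B) x) \<longlonglongrightarrow> bop_apply ((s n - A) * B) x"
          by (auto intro!: tendsto_intros A)
        then show "norm (bop_apply ((s n - A) * B) x) \<le> e / 2 * norm x"
        proof (rule norm_le_of_pointwise_limit)
          fix m
          assume "m \<ge> N"
          then have "norm ((s n - s m) * B) * norm x \<le> e / 2 * norm x"
            using N[OF n] 1(2) by (intro mult_right_mono) (auto intro: less_imp_le)
          then show "norm (bop_apply ((s n - s m) * B) x) \<le> e / 2 * norm x"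
            using norm_bop_apply order_trans by blast
        qed
      qed (use e in simp)
    next
      case (2 B)
      show ?thesis
        unfolding 2(2)
      proof (rule norm_bop_bound)
        fix x
        have "(\<lambda>m. bop_apply (s n - s m) x) \<longlonglongrightarrow> bop_apply (s n - A) x"
          by (auto intro!: tendsto_intros A)
        then have "(\<lambda>m. bop_apply B (bop_apply (s n - s m) x)) \<longlonglongrightarrow> bop_apply B (bop_apply (s n - A) x)"
          by (rule bounded_linear.tendsto[OF bounded_linear_bop_apply])
        then have "(\<lambda>m. bop_apply (B * (s n - s m)) x) \<longlonglongrightarrow> bop_apply (B * (s n - A)) x"
          by simp
        then show "norm (bop_apply (B * (s n - A)) x) \<le> e / 2 * norm x"
        proof (rule norm_le_of_pointwise_limit)
          fix m
          assume "m \<ge> N"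
          then have "norm (B * (s n - s m)) * norm x \<le> e / 2 * norm x"
            using N[OF n] 2(2) by (intro mult_right_mono) (auto intro: less_imp_le)
          then show "norm (bop_apply (B * (s n - s m)) x) \<le> e / 2 * norm x"
            using norm_bop_apply order_trans by blast
        qed
      qed (use e in simp)
    qed
    then show ?thesis
      using e unfolding eventually_sequentially by (intro exI[of _ N]) force
  qed
  have "limitin strict_topology s A sequentially"
    unfolding limitin_def
  proof (intro conjI allI impI)
    show "A \<in> topspace strict_topology"
      by (simp add: strict_topology_eq topspace_seminorm_topology[OF strict_seminorms_facts])
    fix U
    assume "openin strict_topology U \<and> A \<in> U"
    then obtain Q e where Q: "finite Q" "Q \<subseteq> strict_seminorms" "e > 0" "seminorm_ball Q A e \<subseteq> U"
      using openin_seminorm_topology_iff[OF strict_seminorms_facts] unfolding strict_topology_eq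
      by meson
    have "eventually (\<lambda>n. \<forall>q\<in>Q. q (s n - A) < e) sequentially"
      using Q by (intro eventually_ball_finite ballI ev) auto
    then show "eventually (\<lambda>n. s n \<in> U) sequentially"
      by eventually_elim (use Q(4) in \<open>auto simp: seminorm_ball_def\<close>)
  qed
  then show "\<exists>l. limitin strict_topology s l sequentially"
    by blast
qed

section \<open>Comparison with the norm topology\<close>

lemma open_of_strict_open:
  assumes "openin strict_topology U"
  shows "open U"
  unfolding open_dist
proof
  fix x
  assume "x \<in> U"
  then obtain Q e where Q: "finite Q" "Q \<subseteq> strict_seminorms" "e > 0" "seminorm_ball Q x e \<subseteq> U"
    using assms openin_seminorm_topology_iff[OF strict_seminorms_facts] unfolding strict_topology_eq
    by meson
  obtain c where c: "\<And>q. q \<in> Q \<Longrightarrow> 0 \<le> c q \<and> (\<forall>A. q A \<le> c q * norm A)"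
    using strict_seminorms_le Q(2) by (metis subsetD)
  define C where "C = (\<Sum>q\<in>Q. c q) + 1"
  have "(\<Sum>q\<in>Q. c q) \<ge> 0"
    using c by (intro sum_nonneg) auto
  then have C: "C > 0"
    by (simp add: C_def)
  have "y \<in> U" if y: "dist y x < e / C" for y
  proof -
    have "q (y - x) < e" if q: "q \<in> Q" for q
    proof -
      have "c q \<le> C"
        using member_le_sum[OF q _ Q(1), of c] c by (simp add: C_def)
      then have "q (y - x) \<le> C * norm (y - x)"
        using c[OF q] mult_right_mono[of "c q" C "norm (y - x)"] order_trans by fastforce
      also have "\<dots> < e"
        using y C by (simp add: dist_norm field_simps)
      finally show ?thesis .
    qed
    then show ?thesis
      using Q(4) by (auto simp: seminorm_ball_def)
  qed
  then show "\<exists>d>0. \<forall>y. dist y x < d \<longrightarrow> y \<in> U"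
    using Q(3) C by (intro exI[of _ "e / C"]) auto
qed

text \<open>Strict boundedness gives pointwise boundedness through rank one seminorms, and
  Banach-Steinhaus makes it uniform. Conversely a norm bounded set is absorbed by norm balls, hence
  by strict neighbourhoods of 0.\<close>

lemma bounded_in_strict_iff:
  fixes S :: "'h::chilbert_space bop set"
  shows "bounded_in strict_topology S \<longleftrightarrow> bounded S"
proof
  assume S: "bounded_in strict_topology S"
  have "\<exists>c. \<forall>f\<in>bop_apply ` S. norm (f x) \<le> c" for x
  proof (cases "x = 0")
    case False
    let ?q = "\<lambda>A. norm (A * rank1 x x)"
    have "openin strict_topology (seminorm_ball {?q} 0 1)" "0 \<in> seminorm_ball {?q} 0 1"
      using openin_seminorm_ball[OF strict_seminorms_facts, of "{?q}"]
        mem_seminorm_ball[OF strict_seminorms_facts, of "{?q}"] rank1_strict_seminorm[of x]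
      by (auto simp: strict_topology_eq)
    then obtain r where r: "r > 0" "\<And>c. r \<le> cmod c \<Longrightarrow> S \<subseteq> (\<lambda>A. c *\<^sub>C A) ` seminorm_ball {?q} 0 1"
      using S unfolding bounded_in_def by blast
    have "norm (bop_apply A x) \<le> r / norm x" if "A \<in> S" for A
    proof -
      have "A \<in> (\<lambda>A. complex_of_real r *\<^sub>C A) ` seminorm_ball {?q} 0 1"
        using r(2)[of "complex_of_real r"] r(1) that by auto
      then obtain A' where A': "A = complex_of_real r *\<^sub>C A'" "?q A' < 1"
        by (auto simp: seminorm_ball_def)
      have "norm (bop_apply A x) * norm x \<le> ?q A"
        by (rule norm_times_rank1_ge)
      also have "\<dots> = r * ?q A'"
        using r(1) by (simp add: A'(1) norm_scaleC)
      also have "\<dots> \<le> r * 1"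
        using A'(2) r(1) by (intro mult_left_mono) auto
      finally show ?thesis
        using False by (simp add: field_simps)
    qed
    then show ?thesis
      by blast
  qed auto
  then obtain C where C: "C > 0" "\<And>f x. f \<in> bop_apply ` S \<Longrightarrow> norm (f x) \<le> C * norm x"
    using Banach_Steinhaus[of "bop_apply ` S"] bounded_linear_bop_apply by (metis imageE)
  have "norm A \<le> C" if "A \<in> S" for A
    using C that by (intro norm_bop_bound) auto
  then show "bounded S"
    by (auto simp: bounded_iff)
next
  assume "bounded S"
  then obtain M where M: "M > 0" "\<And>A. A \<in> S \<Longrightarrow> norm A \<le> M"
    by (auto simp: bounded_pos)
  show "bounded_in strict_topology S"
    unfolding bounded_in_def
  proof (intro allI impI)
    fix U :: "'h bop set"
    assume "openin strict_topology U \<and> 0 \<in> U"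
    then obtain d where d: "d > 0" "\<And>A. norm A < d \<Longrightarrow> A \<in> U"
      using open_of_strict_open by (metis dist_0_norm dist_commute open_dist)
    \<comment> \<open>The factor 2 yields the strict inequality
      \<open>M / cmod c < d\<close>.\<close>
    have "S \<subseteq> (\<lambda>A. c *\<^sub>C A) ` U" if c: "2 * M / d \<le> cmod c" for c
    proof
      fix A
      assume A: "A \<in> S"
      have c0: "cmod c > 0"
        using c M(1) d(1) by (smt (verit) divide_pos_pos)
      have "norm (inverse c *\<^sub>C A) = norm A / cmod c"
        by (simp add: norm_scaleC norm_inverse divide_inverse mult.commute)
      also have "\<dots> \<le> M / cmod c"
        using M(2)[OF A] c0 by (intro divide_right_mono) auto
      also have "\<dots> < d"
        using c c0 M(1) d(1) by (simp add: field_simps)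
      finally have "inverse c *\<^sub>C A \<in> U"
        by (rule d(2))
      moreover have "A = c *\<^sub>C (inverse c *\<^sub>C A)"
        using c0 by (simp add: scaleC_scaleC scaleC_one)
      ultimately show "A \<in> (\<lambda>A. c *\<^sub>C A) ` U"
        by blast
    qed
    then show "\<exists>r>0. \<forall>c. r \<le> cmod c \<longrightarrow> S \<subseteq> (\<lambda>A. c *\<^sub>C A) ` U"
      using M(1) d(1) by (intro exI[of _ "2 * M / d"]) auto
  qed
qed

section \<open>Countable convexity\<close>

lemma strict_continuous_of_tendsto:
  fixes p :: "'h::chilbert_space bop \<Rightarrow> real"
  assumes p: "cseminorm p" and le: "\<And>A. p A \<le> C * norm A" and C: "0 \<le> C"
    and lim: "(p \<longlongrightarrow> 0) strong_star_at_0"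
  shows "continuous_map strict_topology euclidean p"
proof -
  \<comment> \<open>The converse half of the criterion is the domination for a family with one
    member.\<close>
  have "\<exists>B c. compact_bop B \<and> 0 \<le> c \<and> (\<forall>p\<in>{p}. \<forall>A. p A \<le> c * (norm (A * B) + norm (B * A)))"
    by (rule strict_domination[of _ C])
       (use p le C strong_star_small_off_finite[OF p lim] in auto)
  then obtain B c where B: "compact_bop B" "0 \<le> c" "\<And>A. p A \<le> c * (norm (A * B) + norm (B * A))"
    by auto
  \<comment> \<open>As a set, \<open>Q\<close> may collapse to a single seminorm, for instance if
    \<open>B = 0\<close>; each of the two norms is therefore bounded by the sum separately, whence
    the constant \<open>2 * c\<close>.\<close>
  define Q where "Q = {\<lambda>A. norm (A * B), \<lambda>A. norm (B * A)}"
  have Q: "finite Q" "Q \<subseteq> strict_seminorms"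
    using strict_seminormsI[OF B(1)] by (auto simp: Q_def)
  have "p A \<le> (2 * c) * (\<Sum>q\<in>Q. q A)" for A
  proof -
    have *: "q A \<le> (\<Sum>q\<in>Q. q A)" if "q \<in> Q" for q
      using that Q(1) by (intro member_le_sum) (auto simp: Q_def)
    have "norm (A * B) + norm (B * A) \<le> 2 * (\<Sum>q\<in>Q. q A)"
      using *[of "\<lambda>A. norm (A * B)"] *[of "\<lambda>A. norm (B * A)"] by (simp add: Q_def)
    then have "c * (norm (A * B) + norm (B * A)) \<le> c * (2 * (\<Sum>q\<in>Q. q A))"
      using B(2) by (rule mult_left_mono)
    then show ?thesis
      using B(3)[of A] by simp
  qed
  then show ?thesis
    unfolding strict_topology_eq using B(2)
    by (intro seminorm_continuous_of_bound[OF strict_seminorms_facts p Q, of "2 * c"]) auto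
qed

text \<open>On the unit ball the tail of the series is at most the tail of \<open>\<alpha>\<close>,
  uniformly, because every \<open>p n\<close> is below the norm. A direct proof would have to merge
  the compact operators dominating the single \<open>p n\<close>; the criterion spares this.\<close>

lemma countably_convex_strict:
  "countably_convex (dominated_seminorms (strict_topology :: 'h::chilbert_space bop topology))"
  unfolding countably_convex_def
proof (intro allI impI, elim conjE)
  fix p :: "nat \<Rightarrow> 'h bop \<Rightarrow> real" and \<alpha> :: "nat \<Rightarrow> real"
  assume "\<forall>n. p n \<in> dominated_seminorms strict_topology" and \<alpha>0: "\<forall>n. 0 \<le> \<alpha> n" and \<alpha>: "\<alpha> sums 1"
  then have p: "cseminorm (p n)" "continuous_map strict_topology euclidean (p n)" "p n A \<le> norm A"
    for n A
    by (auto simp: dominated_seminorms_def)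
  have p0: "0 \<le> p n A" for n A
    by (rule cseminorm_nonneg[OF p(1)])
  define q where "q A = (\<Sum>n. \<alpha> n * p n A)" for A
  have le: "\<alpha> n * p n A \<le> \<alpha> n * norm A" for n A
    using \<alpha>0 p(3) by (intro mult_left_mono) auto
  have summ: "summable (\<lambda>n. \<alpha> n * p n A)" for A
  proof (rule summable_comparison_test')
    show "summable (\<lambda>n. \<alpha> n * norm A)"
      using \<alpha> by (intro summable_mult2) (rule sums_summable)
    show "norm (\<alpha> n * p n A) \<le> \<alpha> n * norm A" for n
      using \<alpha>0 p0 le by simp
  qed
  have q_le: "q A \<le> norm A" for A
  proof -
    have "q A \<le> (\<Sum>n. \<alpha> n * norm A)"
      unfolding q_def using \<alpha> by (intro suminf_le le summ summable_mult2) (rule sums_summable)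
    also have "\<dots> = norm A"
      using sums_mult2[OF \<alpha>, of "norm A"] by (simp add: sums_unique[symmetric])
    finally show ?thesis .
  qed
  have q: "cseminorm q"
    unfolding cseminorm_def
  proof (intro conjI allI)
    fix A B :: "'h bop" and c
    have "q (A + B) \<le> (\<Sum>n. \<alpha> n * p n A + \<alpha> n * p n B)"
      unfolding q_def
    proof (intro suminf_le summ summable_add)
      show "\<alpha> n * p n (A + B) \<le> \<alpha> n * p n A + \<alpha> n * p n B" for n
        using mult_left_mono[OF cseminorm_triangle[OF p(1)]] \<alpha>0 by (simp flip: distrib_left)
    qed
    also have "\<dots> = q A + q B"
      unfolding q_def by (rule suminf_add[OF summ summ, symmetric])
    finally show "q (A + B) \<le> q A + q B" .
    have "q (c *\<^sub>C A) = (\<Sum>n. cmod c * (\<alpha> n * p n A))"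
      by (simp add: q_def cseminorm_scaleC[OF p(1)] mult_ac)
    also have "\<dots> = cmod c * q A"
      unfolding q_def by (rule suminf_mult[OF summ])
    finally show "q (c *\<^sub>C A) = cmod c * q A" .
  qed
  have "(q \<longlongrightarrow> 0) strong_star_at_0"
  proof (rule tendstoI)
    fix e :: real
    assume e: "e > 0"
    \<comment> \<open>The weights beyond \<open>N\<close> sum to less than \<open>e / 2\<close>; the
      first \<open>N\<close> seminorms are handled by their own limits.\<close>
    obtain N where N: "norm ((\<Sum>n<N. \<alpha> n) - 1) < e / 2"
      using LIMSEQ_D[OF \<alpha>[unfolded sums_def], of "e / 2"] e by auto
    have "((\<lambda>A. \<Sum>n<N. \<alpha> n * p n A) \<longlongrightarrow> (\<Sum>n<N. \<alpha> n * 0)) strong_star_at_0"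
      by (intro tendsto_intros strict_continuous_imp(1) p)
    then have "eventually (\<lambda>A. (\<Sum>n<N. \<alpha> n * p n A) < e / 2) strong_star_at_0"
      using e by (intro order_tendstoD(2)[where y = 0]) auto
    then show "eventually (\<lambda>A. dist (q A) 0 < e) strong_star_at_0"
      using eventually_strong_star_norm
    proof eventually_elim
      case (elim A)
      have s: "summable (\<lambda>n. \<alpha> (n + N))"
        using sums_summable[OF \<alpha>] by (rule summable_ignore_initial_segment)
      have "(\<Sum>n. \<alpha> (n + N) * p (n + N) A) \<le> (\<Sum>n. \<alpha> (n + N))"
      proof (intro suminf_le s summable_ignore_initial_segment[OF summ])
        fix n
        have "\<alpha> (n + N) * p (n + N) A \<le> \<alpha> (n + N) * 1"
          using \<alpha>0 p(3)[of "n + N" A] elim(2) by (intro mult_left_mono) auto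
        then show "\<alpha> (n + N) * p (n + N) A \<le> \<alpha> (n + N)"
          by simp
      qed
      also have "\<dots> = 1 - (\<Sum>n<N. \<alpha> n)"
        using suminf_split_initial_segment[OF sums_summable[OF \<alpha>], of N] sums_unique[OF \<alpha>] by simp
      also have "\<dots> < e / 2"
        using N unfolding real_norm_def by linarith
      finally have "q A < e / 2 + e / 2"
        using suminf_split_initial_segment[OF summ[of A], of N] elim(1) by (simp add: q_def)
      then show ?case
        using cseminorm_nonneg[OF q, of A] by simp
    qed
  qed
  then have "continuous_map strict_topology euclidean q"
    by (intro strict_continuous_of_tendsto[OF q, of 1]) (simp_all add: q_le)
  then show "(\<lambda>A. \<Sum>n. \<alpha> n * p n A) \<in> dominated_seminorms strict_topology"
    using q q_le unfolding dominated_seminorms_def q_def[abs_def] by simp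
qed

theorem corollary8p4:
  "strong_Mackey (strict_topology :: 'h::chilbert_space bop topology) \<and>
   condition_C (strict_topology :: 'h bop topology)"
  unfolding condition_C_def
  using strong_Mackey_strict[where 'h='h] sequentially_complete_strict open_of_strict_open
    bounded_in_strict_iff countably_convex_strict
  by (auto simp: strong_Mackey_def)

end
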